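(* Let $d\ge1$, $\alpha\in(0,1]$, and let $h:\mathbb{R}^d\to\mathbb{R}$ be an $\alpha$-H\"older function, i.e. $[h]_\alpha<\infty$. Let $f_h$ be the solution of the Stein equation $\Delta f(x)-x\cdot\nabla f(x)=h(x)-\mathbb{E}\,h(Z)$, $x\in\mathbb{R}^d$, given by $$f_h(x)=-\int_0^1\frac{1}{2t}\,\mathbb{E}\left[h(\sqrt t\,x+\sqrt{1-t}\,Z)-h(Z)\right]dt .$$ Set $$C_1(\alpha,d)=2^{\frac{\alpha}{2}+1}\,\frac{\alpha+2d}{\alpha d}\,\frac{\Gamma\left(\frac{\alpha+d}{2}\right)}{\Gamma(d/2)} .$$ Then for all $x,y\in\mathbb{R}^d$ with $x\neq y$: $$\|\nabla^2 f_h(x)-\nabla^2 f_h(y)\|_{op}\leq [h]_\alpha\,|x-y|^\alpha\left(C_1(\alpha,d)-2\log|x-y|\right)\quad\text{if }|x-y|\leq 1,$$ $$\|\nabla^2 f_h(x)-\nabla^2 f_h(y)\|_{op}\leq C_1(\alpha,d)\,[h]_\alpha\quad\text{if }|x-y|>1 .$$ In particular, for all $0<\beta<\alpha$, each $\frac{\partial^2 f_h}{\partial x_i\partial x_j}$ is globally $\beta$-H\"older, and $$\|\nabla^2 f_h(x)-\nabla^2 f_h(y)\|_{op}\leq\left(C_1(\alpha,d)+\frac{2}{\alpha-\beta}\right)|x-y|^{\beta}\,[h]_\alpha .$$ Moreover, $$\|\nabla^2 f_h(x)-\nabla^2 f_h(y)\|_{op}\leq |x-y|^{\alpha}\left(C_1(\alpha,d)+\big|\log|x-y|\big|\right)[h]_\alpha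 .$$
   Context: $Z\sim\mathcal N(0,I_d)$ is a standard $d$-dimensional Gaussian vector. $x\cdot y$ and $|x|$ denote the Euclidean scalar product and norm; $\nabla^2 f$ is the Hessian matrix of $f$; $\|M\|_{op}=\sup_{|x|=1}|Mx|$ is the operator norm of a $d\times d$ matrix; $\log$ is the natural logarithm; $\Gamma$ is the Gamma function. For $\alpha\in(0,1]$, the $\alpha$-H\"older semi-norm is $[h]_\alpha=\sup_{x\neq y}\frac{|h(x)-h(y)|}{|x-y|^\alpha}$. *)

theory Defs
  imports "HOL-Probability.Probability"
begin

definition std_gaussian_vector :: "'w measure \<Rightarrow> ('w \<Rightarrow> real ^ 'n) \<Rightarrow> bool" where
  "std_gaussian_vector M Z \<longleftrightarrow>
     prob_space M \<and> distributed M lborel Z (\<lambda>z. ennreal (\<Prod>i\<in>UNIV. std_normal_density (z $ i)))"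

text \<open>The supremum is taken in \<^typ>\<open>ennreal\<close>, so that finiteness is a genuine condition;
  real-valued estimates use \<^const>\<open>enn2real\<close> of it.\<close>

definition holder_seminorm :: "real \<Rightarrow> (real ^ 'n \<Rightarrow> real) \<Rightarrow> ennreal" where
  "holder_seminorm \<alpha> h = (SUP (x, y) \<in> {(x, y). x \<noteq> y}. ennreal (\<bar>h x - h y\<bar> / norm (x - y) powr \<alpha>))"

definition partial_deriv :: "'n \<Rightarrow> (real ^ 'n \<Rightarrow> real) \<Rightarrow> real ^ 'n \<Rightarrow> real" where
  "partial_deriv i f x = deriv (\<lambda>s. f (x + s *\<^sub>R axis i 1)) 0"

definition gradient :: "(real ^ 'n \<Rightarrow> real) \<Rightarrow> real ^ 'n \<Rightarrow> real ^ 'n" where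
  "gradient f x = (\<chi> i. partial_deriv i f x)"

definition hessian :: "(real ^ 'n \<Rightarrow> real) \<Rightarrow> real ^ 'n \<Rightarrow> real ^ 'n ^ 'n" where
  "hessian f x = (\<chi> i j. partial_deriv i (partial_deriv j f) x)"

definition laplacian :: "(real ^ 'n \<Rightarrow> real) \<Rightarrow> real ^ 'n \<Rightarrow> real" where
  "laplacian f x = (\<Sum>i\<in>UNIV. partial_deriv i (partial_deriv i f) x)"

text \<open>As \<^const>\<open>deriv\<close> is total, the derivatives above carry meaning only for functions
  satisfying the next predicate.\<close>

definition twice_differentiable :: "(real ^ 'n \<Rightarrow> real) \<Rightarrow> bool" where
  "twice_differentiable f \<longleftrightarrow>
     (\<forall>x. f differentiable (at x)) \<and> (\<forall>x. gradient f differentiable (at x))"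

definition op_norm :: "real ^ 'n ^ 'm \<Rightarrow> real" where
  "op_norm A = onorm (\<lambda>v. A *v v)"

definition stein_solution ::
  "'w measure \<Rightarrow> ('w \<Rightarrow> real ^ 'n) \<Rightarrow> (real ^ 'n \<Rightarrow> real) \<Rightarrow> real ^ 'n \<Rightarrow> real" where
  "stein_solution M Z h x =
     - (LINT t:{0..1}|lborel.
          1 / (2 * t) *
          (LINT \<omega>|M. h (sqrt t *\<^sub>R x + sqrt (1 - t) *\<^sub>R Z \<omega>) - h (Z \<omega>)))"

definition C1 :: "real \<Rightarrow> nat \<Rightarrow> real" where
  "C1 \<alpha> d = 2 powr (\<alpha> / 2 + 1) * ((\<alpha> + 2 * real d) / (\<alpha> * real d)) *
     (Gamma ((\<alpha> + real d) / 2) / Gamma (real d / 2))"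

end

(*
  Differentiating under the integral sign in the Gaussian density (rather than in h) gives
    D^2 f(x)[u,u] = - int_0^1 1/(2(1-t)) E[((u.Z)^2 - 1) h(sqrt t x + sqrt(1-t) Z)] dt.
  With r = |x - y| <= 1, the difference of the integrands at x and y is bounded in two ways:
  by L r^alpha E|(u.Z)^2 - 1| / (2(1-t)), which is used for t <= 1 - r^2, and, since the weight
  has mean zero, by L (1-t)^(alpha/2-1) E[|(u.Z)^2 - 1| |Z|^alpha], which is used near t = 1.
  Since E|(u.Z)^2 - 1| = 4 phi(1) <= 1, the first part contributes at most |log r|, and
  the second is dominated by C_1. For r > 1 the second bound is used on all of [0,1].
  The Stein equation is the fundamental theorem of calculus for t |-> E h(sqrt t x + sqrt(1-t) Z).
*)
theory Submission
  imports Defs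
begin

section \<open>Differentiation under the integral sign\<close>

text \<open>As \<open>h\<close> is merely Hoelder, every derivative has to fall on the Gaussian
  weight, and each one costs a factor (1 - t)^(-1/2). The resulting 1/(1 - t) in the Hessian is not
  integrable at t = 1. Centring gains (1 - t)^(\<alpha>/2), which restores integrability but loses
  all dependence on |x - y|; hence two bounds have to be spliced, and the splice produces the
  logarithm. Space and time derivatives have one source: the density of Z / b + v relative to Z,
  differentiated at (b, v) = (1, 0). Moving v differentiates in x, moving b and v together
  differentiates in t. Two numerical facts fix the constants. The trivial bound 2 for the first
  absolute moment of the weight would only give 2 |log r|; the last inequality of the theorem asks
  for |log r|, which is what the bound 1 delivers. The fractional moment is not computed: it is
  bounded by 3/2 d^(\<alpha>/2), and log-convexity of Gamma compares this number with
  \<open>C1\<close>. Only quadratic forms in unit directions are estimated; symmetry of the Hessian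
  turns them into the operator norm.\<close>

lemma has_derivative_lebesgue_integral:
  fixes f :: "'p::euclidean_space \<Rightarrow> 'a \<Rightarrow> real" and G :: "'a \<Rightarrow> 'p"
  assumes "r > 0"
    and int: "\<And>p. norm (p - p0) < r \<Longrightarrow> integrable M (f p)"
    and G: "integrable M G" and B: "integrable M B"
    and deriv: "\<And>z. z \<in> space M \<Longrightarrow> ((\<lambda>p. f p z) has_derivative (\<lambda>q. G z \<bullet> q)) (at p0)"
    and lip: "\<And>p z. z \<in> space M \<Longrightarrow> norm (p - p0) < r \<Longrightarrow> \<bar>f p z - f p0 z\<bar> \<le> B z * norm (p - p0)"
  shows "((\<lambda>p. \<integral>z. f p z \<partial>M) has_derivative (\<lambda>q. (\<integral>z. G z \<partial>M) \<bullet> q)) (at p0)"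
  unfolding has_derivative_at_within
proof (intro conjI bounded_linear_inner_right, subst tendsto_at_iff_sequentially, intro allI impI)
  fix X :: "nat \<Rightarrow> 'p" assume X: "\<forall>i. X i \<in> UNIV - {p0}" "X \<longlonglongrightarrow> p0"
  define F where "F p z = (f p z - f p0 z - G z \<bullet> (p - p0)) / norm (p - p0)" for p z
  let ?I = "\<lambda>p. ((\<integral>z. f p z \<partial>M) - (\<integral>z. f p0 z \<partial>M) - (\<integral>z. G z \<partial>M) \<bullet> (p - p0)) /\<^sub>R norm (p - p0)"
  obtain N where N: "\<And>i. i \<ge> N \<Longrightarrow> norm (X i - p0) < r"
    using X(2) \<open>r > 0\<close> unfolding LIMSEQ_iff by blast
  have intp0: "integrable M (f p0)"
    using int[of p0] \<open>r > 0\<close> by simp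
  have I: "?I p = (\<integral>z. F p z \<partial>M)" if "norm (p - p0) < r" for p
    unfolding F_def using int[OF that] intp0 G by (simp add: divide_inverse mult.commute)
  \<comment> \<open>The quotient of the remainder is dominated by B + |G|: B controls the increment,
    |G| the linear term. A Lipschitz bound anchored at \<open>p0\<close> thus does the work of a
    bound on nearby derivatives.\<close>
  have "(\<lambda>i. \<integral>z. F (X (i + N)) z \<partial>M) \<longlonglongrightarrow> (\<integral>z. 0 \<partial>M)"
  proof (rule integral_dominated_convergence[where w = "\<lambda>z. B z + norm (G z)"])
    show "integrable M (\<lambda>z. B z + norm (G z))"
      using B G by auto
    show "F (X (i + N)) \<in> borel_measurable M" for i
      unfolding F_def using int[OF N, of "i + N"] intp0 G
      by (intro borel_measurable_divide borel_measurable_diff borel_measurable_inner) auto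
    show "AE z in M. (\<lambda>i. F (X (i + N)) z) \<longlonglongrightarrow> 0"
    proof (rule AE_I2)
      fix z assume z: "z \<in> space M"
      have "((\<lambda>p. (f p z - f p0 z - G z \<bullet> (p - p0)) /\<^sub>R norm (p - p0)) \<longlongrightarrow> 0) (at p0)"
        using deriv[OF z] unfolding has_derivative_at_within by blast
      then have "((\<lambda>p. F p z) \<longlongrightarrow> 0) (at p0)"
        by (simp add: F_def divide_inverse mult.commute)
      then have "(\<lambda>i. F (X i) z) \<longlonglongrightarrow> 0"
        unfolding tendsto_at_iff_sequentially o_def using X by blast
      then show "(\<lambda>i. F (X (i + N)) z) \<longlonglongrightarrow> 0"
        by (rule LIMSEQ_ignore_initial_segment)
    qed
    show "AE z in M. norm (F (X (i + N)) z) \<le> B z + norm (G z)" for i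
    proof (rule AE_I2)
      fix z assume z: "z \<in> space M"
      let ?p = "X (i + N)"
      have pos: "norm (?p - p0) > 0" using X by auto
      have "\<bar>f ?p z - f p0 z - G z \<bullet> (?p - p0)\<bar> \<le> B z * norm (?p - p0) + norm (G z) * norm (?p - p0)"
        using lip[OF z N, of "i + N"] Cauchy_Schwarz_ineq2[of "G z" "?p - p0"] by simp
      then show "norm (F ?p z) \<le> B z + norm (G z)"
        using pos unfolding F_def by (simp add: divide_le_eq distrib_right)
    qed
  qed simp_all
  then have "(\<lambda>i. ?I (X (i + N))) \<longlonglongrightarrow> 0"
    using I N by simp
  then show "(?I \<circ> X) \<longlonglongrightarrow> 0"
    unfolding o_def by (rule LIMSEQ_offset)
qed

section \<open>Affine changes of variable in the standard Gaussian measure\<close>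

definition gauss_density :: "'a::euclidean_space \<Rightarrow> real" where
  "gauss_density z = (1 / sqrt (2 * pi)) ^ DIM('a) * exp (- (norm z)\<^sup>2 / 2)"

text \<open>An abstract Euclidean space is used up to the final theorem, where the law of
  \<open>Z\<close> is identified with this measure.\<close>

definition gauss :: "'a::euclidean_space measure" where
  "gauss = density lborel (\<lambda>z. ennreal (gauss_density z))"

lemma gauss_density_pos: "gauss_density z > 0"
  by (simp add: gauss_density_def)

lemma gauss_density_measurable [measurable]: "gauss_density \<in> borel_measurable borel"
  unfolding gauss_density_def[abs_def] by measurable

text \<open>Bridge between the norm form, suited to dilations and shifts, and the product form,
  suited to Fubini and to the coordinate definition of a Gaussian vector.\<close>

lemma gauss_density_prod: "gauss_density z = (\<Prod>b\<in>Basis. std_normal_density (z \<bullet> b))"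
proof -
  have "(norm z)\<^sup>2 = (\<Sum>b\<in>Basis. (z \<bullet> b)\<^sup>2)"
    by (subst power2_norm_eq_inner, subst euclidean_inner) (simp add: power2_eq_square)
  then show ?thesis
    by (simp add: gauss_density_def std_normal_density_def prod_dividef power_divide
        sum_divide_distrib exp_sum flip: sum_negf)
qed

lemma sets_gauss [simp, measurable_cong]: "sets gauss = sets borel"
  by (simp add: gauss_def)

lemma space_gauss [simp]: "space gauss = UNIV"
  by (simp add: gauss_def)

lemma prob_space_gauss: "prob_space gauss"
proof
  have "emeasure (gauss :: 'a measure) (space gauss) = (\<integral>\<^sup>+z. (\<Prod>b\<in>Basis. ennreal (std_normal_density (z \<bullet> b))) \<partial>(lborel :: 'a measure))"
    by (simp add: gauss_def emeasure_density gauss_density_prod prod_ennreal)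
  also have "\<dots> = (\<Prod>b\<in>(Basis :: 'a set). \<integral>\<^sup>+x. ennreal (std_normal_density x) \<partial>lborel)"
    by (rule nn_integral_lborel_prod) auto
  also have "(\<integral>\<^sup>+x. ennreal (std_normal_density x) \<partial>lborel) = 1"
    using prob_space.emeasure_space_1[OF prob_space_normal_density[of 1 0]]
    by (simp add: emeasure_density)
  finally show "emeasure (gauss :: 'a measure) (space gauss) = 1" by simp
qed

interpretation gauss: prob_space gauss
  by (rule prob_space_gauss)

lemma measure_gauss_UNIV [simp]: "measure gauss UNIV = 1"
  using gauss.prob_space by simp

text \<open>Density with respect to \<^term>\<open>gauss\<close> of the law of \<open>Z / b + v\<close>; putting the parameters into
  this density makes Gaussian averages of merely continuous functions differentiable in them.\<close>

definition affine_ratio :: "real \<Rightarrow> 'a::euclidean_space \<Rightarrow> 'a \<Rightarrow> real" where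
  "affine_ratio b v z = b ^ DIM('a) * exp (((norm z)\<^sup>2 - b\<^sup>2 * (norm (z - v))\<^sup>2) / 2)"

lemma affine_ratio_measurable [measurable]: "affine_ratio b v \<in> borel_measurable borel"
  unfolding affine_ratio_def[abs_def] by measurable

lemma affine_ratio_nonneg: "b > 0 \<Longrightarrow> affine_ratio b v z \<ge> 0"
  by (simp add: affine_ratio_def)

text \<open>Change of variables: \<open>affine_ratio\<close> is the Jacobian b^d times the quotient
  of the Gaussian density at b (z - v) by the one at z.\<close>

lemma distr_gauss_affine:
  fixes v :: "'a::euclidean_space"
  assumes "b > 0"
  shows "distr gauss borel (\<lambda>z. z /\<^sub>R b + v) = density gauss (\<lambda>z. ennreal (affine_ratio b v z))"
proof (rule measure_eqI)
  fix A :: "'a set" assume "A \<in> sets (distr gauss borel (\<lambda>z. z /\<^sub>R b + v))"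
  then have A [measurable]: "A \<in> sets borel" by simp
  have "emeasure (distr gauss borel (\<lambda>z. z /\<^sub>R b + v)) A
      = (\<integral>\<^sup>+z. indicator A z \<partial>distr gauss borel (\<lambda>z. z /\<^sub>R b + v))" by simp
  also have "\<dots> = (\<integral>\<^sup>+z. indicator A (z /\<^sub>R b + v) \<partial>gauss)"
    by (subst nn_integral_distr) auto
  also have "\<dots> = (\<integral>\<^sup>+z. ennreal (gauss_density z) * indicator A (z /\<^sub>R b + v) \<partial>lborel)"
    by (simp add: gauss_def nn_integral_density)
  \<comment> \<open>Lebesgue measure is transported by z -> b z - b v = b (z - v), the inverse of z
    -> z / b + v, so that the indicator is evaluated at z itself.\<close>
  also have "\<dots> = (\<integral>\<^sup>+z. ennreal (b ^ DIM('a)) *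
      (ennreal (gauss_density (b *\<^sub>R (z - v))) * indicator A z) \<partial>lborel)"
    using assms
    by (subst lborel_affine[of b "- b *\<^sub>R v"])
       (auto simp: nn_integral_density nn_integral_distr algebra_simps)
  also have "\<dots> = (\<integral>\<^sup>+z. ennreal (gauss_density z) * (ennreal (affine_ratio b v z) * indicator A z) \<partial>lborel)"
  proof (rule nn_integral_cong)
    fix z :: 'a
    have "b ^ DIM('a) * gauss_density (b *\<^sub>R (z - v)) = gauss_density z * affine_ratio b v z"
      unfolding gauss_density_def affine_ratio_def
      by (simp add: power_mult_distrib flip: exp_add) (simp add: field_simps)
    then show "ennreal (b ^ DIM('a)) * (ennreal (gauss_density (b *\<^sub>R (z - v))) * indicator A z)
        = ennreal (gauss_density z) * (ennreal (affine_ratio b v z) * indicator A z)"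
      using assms
      by (simp add: mult.assoc[symmetric] gauss_density_pos less_imp_le affine_ratio_nonneg flip: ennreal_mult'' ennreal_mult)
  qed
  also have "\<dots> = (\<integral>\<^sup>+z. ennreal (affine_ratio b v z) * indicator A z \<partial>gauss)"
    by (simp add: gauss_def nn_integral_density)
  also have "\<dots> = emeasure (density gauss (\<lambda>z. ennreal (affine_ratio b v z))) A"
    by (simp add: emeasure_density)
  finally show "emeasure (distr gauss borel (\<lambda>z. z /\<^sub>R b + v)) A
      = emeasure (density gauss (\<lambda>z. ennreal (affine_ratio b v z))) A" .
qed simp

lemma integral_gauss_affine:
  fixes k :: "'a::euclidean_space \<Rightarrow> real"
  assumes "b > 0" and [measurable]: "k \<in> borel_measurable borel"
  shows "(\<integral>z. k (z /\<^sub>R b + v) \<partial>gauss) = (\<integral>z. affine_ratio b v z * k z \<partial>gauss)"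
proof -
  have "(\<integral>z. k (z /\<^sub>R b + v) \<partial>gauss) = (\<integral>z. k z \<partial>distr gauss borel (\<lambda>z. z /\<^sub>R b + v))"
    by (subst integral_distr) auto
  also have "\<dots> = (\<integral>z. affine_ratio b v z * k z \<partial>gauss)"
    unfolding distr_gauss_affine[OF assms(1)]
    by (subst integral_density) (auto simp: affine_ratio_nonneg assms(1))
  finally show ?thesis .
qed

text \<open>Up to a constant, the integrand is the density of the law of \<open>Z / b\<close> with \<open>b\<^sup>2 = 1 - 2 a\<close>.\<close>

lemma integrable_gauss_exp:
  assumes "a < 1 / 2"
  shows "integrable gauss (\<lambda>z::'a::euclidean_space. exp (a * (norm z)\<^sup>2))"
proof -
  define b where "b = sqrt (1 - 2 * a)"
  have b: "b > 0" "b\<^sup>2 = 1 - 2 * a" using assms by (auto simp: b_def)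
  have "integrable (distr gauss borel (\<lambda>z::'a. z /\<^sub>R b + 0)) (\<lambda>_. 1 :: real)"
    by (subst integrable_distr_eq) auto
  then have "integrable gauss (\<lambda>z::'a. affine_ratio b 0 z)"
    unfolding distr_gauss_affine[OF b(1)]
    by (subst (asm) integrable_density) (auto simp: affine_ratio_nonneg b(1))
  then have "integrable gauss (\<lambda>z::'a. b ^ DIM('a) * exp (a * (norm z)\<^sup>2))"
    unfolding affine_ratio_def b by (simp add: algebra_simps)
  then show ?thesis using b by simp
qed

section \<open>Functions of polynomial growth and their Gaussian integrability\<close>

lemma power_le_exp_square:
  obtains C :: real where "C > 0" "\<And>r. r \<ge> 0 \<Longrightarrow> (1 + r) ^ m \<le> C * exp (r\<^sup>2 / 8)"
proof (cases "m = 0")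
  case True
  then show ?thesis by (intro that[of 1]) auto
next
  case False
  have "(1 + r) ^ m \<le> (1 + 2 * real m) ^ m * exp (r\<^sup>2 / 8)" if "r \<ge> 0" for r :: real
  proof -
    \<comment> \<open>Since an m-th power is taken at the end, each factor may spend only the rate 1
      / (8 m). The total 1/8 is part of a budget: increments of \<open>affine_ratio\<close> will
      spend 1/4, and the sum 3/8 stays below the threshold 1/2 of
      \<open>integrable_gauss_exp\<close>.\<close>
    define e where "e = 1 / (8 * real m)"
    have e: "e > 0" "1 / (4 * e) = 2 * real m" "e * real m = 1 / 8" using False by (auto simp: e_def)
    have "0 \<le> (2 * e * r - 1)\<^sup>2 / (4 * e)" using e by simp
    also have "\<dots> = e * r\<^sup>2 + 2 * real m - r"
      unfolding e(2)[symmetric] using e(1) by (simp add: field_simps power2_eq_square)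
    finally have "1 + r \<le> 1 + 2 * real m + e * r\<^sup>2" by simp
    also have "\<dots> \<le> (1 + 2 * real m) * (1 + e * r\<^sup>2)"
      using e(1) unfolding ring_distribs by simp
    also have "\<dots> \<le> (1 + 2 * real m) * exp (e * r\<^sup>2)"
      by (intro mult_left_mono exp_ge_add_one_self) auto
    finally have "(1 + r) ^ m \<le> ((1 + 2 * real m) * exp (e * r\<^sup>2)) ^ m"
      using that by (intro power_mono) auto
    also have "\<dots> = (1 + 2 * real m) ^ m * exp (r\<^sup>2 / 8)"
      using e(3) by (simp add: power_mult_distrib mult.assoc[symmetric] mult.commute[of _ e] flip: exp_of_nat_mult)
    finally show ?thesis .
  qed
  then show ?thesis by (intro that[of "(1 + 2 * real m) ^ m"]) auto
qed

text \<open>A class closed under sums, products and translations that contains Hoelder functions and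
  polynomial weights; membership replaces a separate integrability argument for each
  integrand.\<close>

definition poly_growth :: "('a::euclidean_space \<Rightarrow> real) \<Rightarrow> bool" where
  "poly_growth k \<longleftrightarrow> k \<in> borel_measurable borel \<and> (\<exists>C m. \<forall>z. \<bar>k z\<bar> \<le> C * (1 + norm z) ^ m)"

lemma poly_growthD [measurable_dest]: "poly_growth k \<Longrightarrow> k \<in> borel_measurable borel"
  by (simp add: poly_growth_def)

lemma poly_growthI:
  "k \<in> borel_measurable borel \<Longrightarrow> (\<And>z. \<bar>k z\<bar> \<le> C * (1 + norm z) ^ m) \<Longrightarrow> poly_growth k"
  by (auto simp: poly_growth_def)

lemma poly_growth_const [simp, intro]: "poly_growth (\<lambda>_. c)"
  by (rule poly_growthI[where C = "\<bar>c\<bar>" and m = 0]) auto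

lemma poly_growth_norm [simp, intro]: "poly_growth (\<lambda>z. norm z)"
  by (rule poly_growthI[where C = 1 and m = 1]) auto

lemma poly_growth_inner [simp, intro]: "poly_growth (\<lambda>z. a \<bullet> z)"
proof (rule poly_growthI[where C = "norm a" and m = 1])
  show "\<bar>a \<bullet> z\<bar> \<le> norm a * (1 + norm z) ^ 1" for z
    using Cauchy_Schwarz_ineq2[of a z] by (simp add: algebra_simps add_increasing)
qed auto

lemma poly_growth_mult [intro]:
  assumes "poly_growth f" "poly_growth g"
  shows "poly_growth (\<lambda>z. f z * g z)"
proof -
  obtain C m D n where C: "\<And>z. \<bar>f z\<bar> \<le> C * (1 + norm z) ^ m" and D: "\<And>z. \<bar>g z\<bar> \<le> D * (1 + norm z) ^ n"
    using assms by (auto simp: poly_growth_def)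
  show ?thesis
  proof (rule poly_growthI[where C = "C * D" and m = "m + n"])
    show "\<bar>f z * g z\<bar> \<le> C * D * (1 + norm z) ^ (m + n)" for z
      using mult_mono[OF C[of z] D[of z] order_trans[OF abs_ge_zero C[of z]] abs_ge_zero]
      by (simp add: abs_mult power_add mult_ac)
  qed (use assms in measurable)
qed

lemma poly_growth_add [intro]:
  assumes "poly_growth f" "poly_growth g"
  shows "poly_growth (\<lambda>z. f z + g z)"
proof -
  obtain C m D n where C: "\<And>z. \<bar>f z\<bar> \<le> C * (1 + norm z) ^ m" and D: "\<And>z. \<bar>g z\<bar> \<le> D * (1 + norm z) ^ n"
    using assms by (auto simp: poly_growth_def)
  show ?thesis
  proof (rule poly_growthI[where C = "\<bar>C\<bar> + \<bar>D\<bar>" and m = "m + n"])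
    fix z :: 'a
    have "\<bar>f z\<bar> \<le> \<bar>C\<bar> * (1 + norm z) ^ (m + n)"
      by (rule order_trans[OF C]) (intro mult_mono power_increasing, auto)
    moreover have "\<bar>g z\<bar> \<le> \<bar>D\<bar> * (1 + norm z) ^ (m + n)"
      by (rule order_trans[OF D]) (intro mult_mono power_increasing, auto)
    ultimately show "\<bar>f z + g z\<bar> \<le> (\<bar>C\<bar> + \<bar>D\<bar>) * (1 + norm z) ^ (m + n)"
      by (simp add: distrib_right)
  qed (use assms in measurable)
qed

lemma poly_growth_minus [intro]: "poly_growth f \<Longrightarrow> poly_growth (\<lambda>z. - f z)"
  using poly_growth_mult[of "\<lambda>_. -1" f] by simp

lemma poly_growth_diff [intro]: "poly_growth f \<Longrightarrow> poly_growth g \<Longrightarrow> poly_growth (\<lambda>z. f z - g z)"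
  using poly_growth_add[of f "\<lambda>z. - g z"] by auto

lemma poly_growth_abs [intro]: "poly_growth f \<Longrightarrow> poly_growth (\<lambda>z. \<bar>f z\<bar>)"
  unfolding poly_growth_def by auto

lemma poly_growth_mono:
  assumes "poly_growth g" "f \<in> borel_measurable borel" "\<And>z. \<bar>f z\<bar> \<le> g z"
  shows "poly_growth f"
  using assms unfolding poly_growth_def by (meson abs_ge_self order_trans)

lemma poly_growth_power [intro]: "poly_growth f \<Longrightarrow> poly_growth (\<lambda>z. f z ^ n)"
  by (induction n) auto

lemma poly_growth_exp_bound:
  assumes "poly_growth k"
  obtains K where "K > 0" "\<And>z. \<bar>k z\<bar> \<le> K * exp ((norm z)\<^sup>2 / 8)"
proof -
  obtain C m where C: "\<And>z. \<bar>k z\<bar> \<le> C * (1 + norm z) ^ m"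
    using assms by (auto simp: poly_growth_def)
  obtain D :: real where D: "D > 0" "\<And>r. r \<ge> 0 \<Longrightarrow> (1 + r) ^ m \<le> D * exp (r\<^sup>2 / 8)"
    using power_le_exp_square[of m] by blast
  have "\<bar>k z\<bar> \<le> ((\<bar>C\<bar> + 1) * D) * exp ((norm z)\<^sup>2 / 8)" for z
  proof -
    have "\<bar>k z\<bar> \<le> (\<bar>C\<bar> + 1) * (1 + norm z) ^ m"
      by (rule order_trans[OF C]) (intro mult_mono, auto)
    also have "\<dots> \<le> (\<bar>C\<bar> + 1) * (D * exp ((norm z)\<^sup>2 / 8))"
      by (intro mult_left_mono D) auto
    finally show ?thesis by (simp add: mult_ac)
  qed
  with D(1) show thesis by (intro that[of "(\<bar>C\<bar> + 1) * D"]) auto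
qed

lemma integrable_gauss_exp_bound:
  fixes k :: "'a::euclidean_space \<Rightarrow> real"
  assumes "k \<in> borel_measurable borel" "\<And>z. \<bar>k z\<bar> \<le> K * exp (3 / 8 * (norm z)\<^sup>2)"
  shows "integrable gauss k"
proof (rule Bochner_Integration.integrable_bound)
  show "integrable gauss (\<lambda>z::'a. K * exp (3 / 8 * (norm z)\<^sup>2))"
    by (intro integrable_mult_right integrable_gauss_exp) auto
  show "AE z in gauss. norm (k z) \<le> norm (K * exp (3 / 8 * (norm z)\<^sup>2))"
    by (intro AE_I2) (use assms(2) in \<open>auto intro: order_trans[OF _ abs_ge_self]\<close>)
qed (use assms(1) in measurable)

lemma poly_growth_integrable:
  assumes "poly_growth k"
  shows "integrable gauss k"
proof -
  obtain K where K: "K > 0" "\<And>z. \<bar>k z\<bar> \<le> K * exp ((norm z)\<^sup>2 / 8)"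
    using poly_growth_exp_bound[OF assms] by blast
  show ?thesis
  proof (rule integrable_gauss_exp_bound)
    show "\<bar>k z\<bar> \<le> K * exp (3 / 8 * (norm z)\<^sup>2)" for z
      by (rule order_trans[OF K(2)]) (use K(1) in \<open>auto intro!: mult_left_mono\<close>)
  qed (use assms in measurable)
qed

lemma poly_growth_integrable_scaleR:
  fixes p :: "'a::euclidean_space \<Rightarrow> 'b::{banach,second_countable_topology}"
  assumes "poly_growth k" "p \<in> borel_measurable borel" "poly_growth (\<lambda>z. norm (p z))"
  shows "integrable gauss (\<lambda>z. k z *\<^sub>R p z)"
  by (rule Bochner_Integration.integrable_bound[OF poly_growth_integrable[OF poly_growth_mult[OF assms(1,3)]]])
     (use assms(1,2) in auto)

section \<open>Dependence of the density ratio on dilation and shift\<close>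

lemma abs_ln_le: "\<bar>b - 1\<bar> \<le> 1 / 2 \<Longrightarrow> \<bar>ln b\<bar> \<le> 2 * \<bar>b - 1\<bar>" for b :: real
proof -
  assume b: "\<bar>b - 1\<bar> \<le> 1 / 2"
  then have "b > 0" by linarith
  have "- ln b = ln (1 / b)" using \<open>b > 0\<close> by (simp add: ln_div)
  also have "\<dots> \<le> 1 / b - 1" using \<open>b > 0\<close> by (intro ln_le_minus_one) auto
  also have "\<dots> = (1 - b) * (1 / b)" using \<open>b > 0\<close> by (simp add: field_simps)
  also have "\<dots> \<le> \<bar>b - 1\<bar> * 2"
    using b \<open>b > 0\<close> by (intro mult_mono) (auto simp: divide_simps abs_if split: if_splits)
  finally show ?thesis using ln_le_minus_one[OF \<open>b > 0\<close>] by (auto simp: abs_if split: if_splits)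
qed

lemma abs_exp_minus_one_le: "\<bar>exp t - 1\<bar> \<le> \<bar>t\<bar> * exp \<bar>t\<bar>" for t :: real
proof (cases "t \<ge> 0")
  case True
  have "1 - t \<le> exp (- t)" using exp_ge_add_one_self[of "-t"] by simp
  then have "(1 - t) * exp t \<le> 1"
    by (metis exp_minus_inverse mult.commute mult_right_mono exp_ge_zero)
  with True show ?thesis by (simp add: algebra_simps)
next
  case False
  have "1 - exp t \<le> - t" using exp_ge_add_one_self[of t] by linarith
  also have "- t \<le> \<bar>t\<bar> * exp \<bar>t\<bar>"
    using False mult_left_mono[of 1 "exp (-t)" "-t"] by simp
  finally show ?thesis using False by simp
qed

text \<open>The ratio is exp \<theta> with |\<theta>| at most n times a polynomial in |z|, and |exp
  t - 1| <= |t| exp |t| keeps the factor n, which makes this the Lipschitz bound at (1, 0) needed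
  for dominated convergence. The polynomial and exp |\<theta>| spend a rate 1/8 each.\<close>

lemma affine_ratio_minus_one_bound:
  fixes v z :: "'a::euclidean_space"
  assumes "norm ((b, v) - (1, 0)) < 1 / 24"
  shows "\<bar>affine_ratio b v z - 1\<bar> \<le>
    8 * (2 * DIM('a) + 3) * exp (2 * DIM('a) + 3) * exp ((norm z)\<^sup>2 / 4) * norm ((b, v) - (1, 0))"
proof -
  define n where "n = norm ((b, v) - (1, 0))"
  define d where "d = real (DIM('a))"
  have n: "\<bar>b - 1\<bar> \<le> n" "norm v \<le> n" "n < 1 / 24" "n \<ge> 0"
    using assms norm_fst_le[of "b - 1" v] norm_snd_le[of v "b - 1"] by (auto simp: n_def)
  have b: "b > 0" "b \<le> 5 / 4" using n by auto
  define \<theta> where "\<theta> = d * ln b + ((norm z)\<^sup>2 - b\<^sup>2 * (norm (z - v))\<^sup>2) / 2"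
  have R: "affine_ratio b v z = exp \<theta>"
    using b by (simp add: affine_ratio_def \<theta>_def d_def exp_add exp_of_nat_mult)
  \<comment> \<open>Separates dilation from shift: the first summand carries the factor 1 - b, the
    second is at least linear in v.\<close>
  have *: "(norm z)\<^sup>2 - b\<^sup>2 * (norm (z - v))\<^sup>2 = (1 - b) * (1 + b) * (norm z)\<^sup>2 + b\<^sup>2 * (2 * (z \<bullet> v) - (norm v)\<^sup>2)"
    unfolding power2_norm_eq_inner by (simp add: inner_diff inner_commute power2_eq_square algebra_simps del: dot_square_norm)
  have 1: "\<bar>(1 - b) * (1 + b) * (norm z)\<^sup>2\<bar> \<le> n * (9 / 4) * (norm z)\<^sup>2"
    unfolding abs_mult using n b by (intro mult_mono) auto
  have 2: "\<bar>b\<^sup>2 * (2 * (z \<bullet> v) - (norm v)\<^sup>2)\<bar> \<le> 2 * (n * (1 + (norm z)\<^sup>2) + n)"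
  proof -
    have "\<bar>z \<bullet> v\<bar> \<le> norm z * n"
      using Cauchy_Schwarz_ineq2[of z v] mult_left_mono[OF n(2), of "norm z"] by simp
    moreover have "2 * norm z \<le> 1 + (norm z)\<^sup>2"
      using zero_le_power2[of "norm z - 1"] unfolding power2_diff by simp
    then have "2 * (norm z * n) \<le> n * (1 + (norm z)\<^sup>2)"
      using mult_left_mono[of "2 * norm z" "1 + (norm z)\<^sup>2" n] n by (simp add: mult_ac)
    moreover have "(norm v)\<^sup>2 \<le> n"
      using mult_mono[of "norm v" n "norm v" 1] n by (simp add: power2_eq_square)
    ultimately have "\<bar>2 * (z \<bullet> v) - (norm v)\<^sup>2\<bar> \<le> n * (1 + (norm z)\<^sup>2) + n"
      using zero_le_power2[of "norm v"] unfolding abs_le_iff by linarith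
    moreover have "b\<^sup>2 \<le> 2"
      using power_mono[OF b(2), of 2] b by (simp add: power2_eq_square)
    ultimately show ?thesis
      unfolding abs_mult by (intro mult_mono) auto
  qed
  have 3: "n * (9 / 4) * (norm z)\<^sup>2 \<le> n * 3 * (norm z)\<^sup>2"
    using n by (intro mult_mono) auto
  have "\<bar>(1 - b) * (1 + b) * (norm z)\<^sup>2 + b\<^sup>2 * (2 * (z \<bullet> v) - (norm v)\<^sup>2)\<bar>
      \<le> n * 3 * (norm z)\<^sup>2 + 2 * (n * (1 + (norm z)\<^sup>2) + n)"
    using abs_triangle_ineq[of "(1 - b) * (1 + b) * (norm z)\<^sup>2" "b\<^sup>2 * (2 * (z \<bullet> v) - (norm v)\<^sup>2)"] 1 2 3
    by linarith
  also have "\<dots> \<le> 2 * (n * (3 * (1 + (norm z)\<^sup>2)))"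
    using n by (simp add: algebra_simps)
  finally have "\<bar>((norm z)\<^sup>2 - b\<^sup>2 * (norm (z - v))\<^sup>2) / 2\<bar> \<le> n * (3 * (1 + (norm z)\<^sup>2))"
    unfolding * by simp
  moreover have "\<bar>d * ln b\<bar> \<le> n * (2 * d)"
    using abs_ln_le[of b] n mult_left_mono[of "\<bar>ln b\<bar>" "2 * n" d] by (simp add: abs_mult d_def)
  ultimately have th: "\<bar>\<theta>\<bar> \<le> n * (2 * d + 3 + 3 * (norm z)\<^sup>2)"
    unfolding \<theta>_def
    using abs_triangle_ineq[of "d * ln b" "((norm z)\<^sup>2 - b\<^sup>2 * (norm (z - v))\<^sup>2) / 2"]
    by (simp only: distrib_left)
  \<comment> \<open>The radius 1/24 is chosen here: 3 n <= 1/8 bounds the coefficient of |z|^2 in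
    the exponent.\<close>
  have th': "\<bar>\<theta>\<bar> \<le> 2 * d + 3 + (norm z)\<^sup>2 / 8"
  proof -
    have "n * (2 * d + 3 + 3 * (norm z)\<^sup>2) \<le> (1 / 24) * (2 * d + 3 + 3 * (norm z)\<^sup>2)"
      using n by (intro mult_right_mono) (auto simp: d_def)
    then show ?thesis using th by (simp add: d_def algebra_simps)
  qed
  have "1 + (norm z)\<^sup>2 / 8 \<le> exp ((norm z)\<^sup>2 / 8)" by (rule exp_ge_add_one_self)
  then have "(2 * d + 3) * (8 * (1 + (norm z)\<^sup>2 / 8)) \<le> (2 * d + 3) * (8 * exp ((norm z)\<^sup>2 / 8))"
    by (intro mult_left_mono) (auto simp: d_def)
  moreover have "2 * d + 3 + 3 * (norm z)\<^sup>2 \<le> (2 * d + 3) * (8 * (1 + (norm z)\<^sup>2 / 8))"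
    by (simp add: algebra_simps d_def)
  ultimately have p: "2 * d + 3 + 3 * (norm z)\<^sup>2 \<le> (2 * d + 3) * (8 * exp ((norm z)\<^sup>2 / 8))"
    by (rule order_trans[rotated])
  have "\<bar>exp \<theta> - 1\<bar> \<le> \<bar>\<theta>\<bar> * exp \<bar>\<theta>\<bar>" by (rule abs_exp_minus_one_le)
  also have "\<dots> \<le> (n * ((2 * d + 3) * (8 * exp ((norm z)\<^sup>2 / 8)))) * exp (2 * d + 3 + (norm z)\<^sup>2 / 8)"
    using th' n p by (intro mult_mono order_trans[OF th] mult_left_mono) (auto simp: d_def)
  also have "\<dots> = 8 * (2 * d + 3) * exp (2 * d + 3) * exp ((norm z)\<^sup>2 / 8 + (norm z)\<^sup>2 / 8) * n"
    by (simp only: exp_add mult_ac)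
  also have "(norm z)\<^sup>2 / 8 + (norm z)\<^sup>2 / 8 = (norm z)\<^sup>2 / 4" by simp
  finally show ?thesis by (simp add: R n_def d_def)
qed

text \<open>The ratio equals 1 at (1, 0), so its derivative is that of its logarithm d ln b + (|z|^2
  - b^2 |z - v|^2) / 2, namely d - |z|^2 in b and z in v.\<close>

lemma affine_ratio_has_derivative:
  fixes z :: "'a::euclidean_space"
  shows "((\<lambda>p. affine_ratio (fst p) (snd p) z) has_derivative (\<lambda>q. (DIM('a) - (norm z)\<^sup>2, z) \<bullet> q)) (at (1, 0))"
proof -
  have "((\<lambda>p. fst p ^ DIM('a) * exp ((z \<bullet> z - (fst p)\<^sup>2 * ((z - snd p) \<bullet> (z - snd p))) / 2))
      has_derivative (\<lambda>q. (DIM('a) - (norm z)\<^sup>2, z) \<bullet> q)) (at (1, 0))"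
    by (auto intro!: derivative_eq_intros ext simp: inner_commute power2_norm_eq_inner algebra_simps inner_prod_def diff_divide_distrib)
  then show ?thesis
    by (simp add: affine_ratio_def power2_norm_eq_inner)
qed

lemma integrable_affine_weight:
  fixes k :: "'a::euclidean_space \<Rightarrow> real"
  assumes "poly_growth k"
  shows "integrable gauss (\<lambda>z. k z *\<^sub>R (DIM('a) - (norm z)\<^sup>2, z))"
proof -
  have "poly_growth (\<lambda>z::'a. norm (DIM('a) - (norm z)\<^sup>2, z))"
    by (rule poly_growth_mono[where g = "\<lambda>z. \<bar>DIM('a) - (norm z)\<^sup>2\<bar> + norm z"])
       (auto intro!: poly_growth_add poly_growth_abs poly_growth_diff poly_growth_power
         order_trans[OF sqrt_sum_squares_le_sum_abs] simp: norm_Pair)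
  then show ?thesis
    by (intro poly_growth_integrable_scaleR assms) auto
qed

text \<open>All smoothness comes from the density, so the average is differentiable for a merely
  measurable \<open>k\<close> of polynomial growth. The majorant has rate 3/8: 1/4 from the ratio
  and 1/8 from \<open>k\<close>.\<close>

lemma affine_gauss_integral_has_derivative:
  fixes k :: "'a::euclidean_space \<Rightarrow> real"
  assumes "poly_growth k"
  shows "((\<lambda>p. \<integral>z. affine_ratio (fst p) (snd p) z * k z \<partial>gauss) has_derivative
    (\<lambda>q. (\<integral>z. k z *\<^sub>R (DIM('a) - (norm z)\<^sup>2, z) \<partial>gauss) \<bullet> q)) (at (1, 0))"
proof -
  note [measurable] = poly_growthD[OF assms]
  obtain K where K: "K > 0" "\<And>z. \<bar>k z\<bar> \<le> K * exp ((norm z)\<^sup>2 / 8)"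
    using poly_growth_exp_bound[OF assms] by blast
  define D where "D = 8 * (2 * DIM('a) + 3) * exp (real (2 * DIM('a) + 3))"
  have D: "D > 0" by (simp add: D_def add_pos_pos)
  have bd: "\<bar>(affine_ratio (fst p) (snd p) z - 1) * k z\<bar> \<le> (K * D) * exp (3 / 8 * (norm z)\<^sup>2) * norm (p - (1, 0))"
    if "norm (p - (1, 0)) < 1 / 24" for p and z :: 'a
  proof -
    have "\<bar>(affine_ratio (fst p) (snd p) z - 1) * k z\<bar> \<le>
       (D * exp ((norm z)\<^sup>2 / 4) * norm (p - (1, 0))) * (K * exp ((norm z)\<^sup>2 / 8))"
      unfolding abs_mult
      using affine_ratio_minus_one_bound[of "fst p" "snd p" z] that K D
      by (intro mult_mono) (auto simp: D_def)
    also have "\<dots> = (K * D) * exp ((norm z)\<^sup>2 / 4 + (norm z)\<^sup>2 / 8) * norm (p - (1, 0))"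
      by (subst exp_add) (simp only: mult_ac)
    also have "(norm z)\<^sup>2 / 4 + (norm z)\<^sup>2 / 8 = 3 / 8 * (norm z)\<^sup>2" by simp
    finally show ?thesis .
  qed
  have intk: "integrable gauss k" by (rule poly_growth_integrable[OF assms])
  have intB: "integrable gauss (\<lambda>z::'a. (K * D) * exp (3 / 8 * (norm z)\<^sup>2))"
    by (intro integrable_mult_right integrable_gauss_exp) auto
  show ?thesis
  proof (rule has_derivative_lebesgue_integral[where r = "1 / 24"
      and B = "\<lambda>z. (K * D) * exp (3 / 8 * (norm z)\<^sup>2)"])
    fix p :: "real \<times> 'a" assume p: "norm (p - (1, 0)) < 1 / 24"
    \<comment> \<open>The bound concerns only the increment of the ratio; integrability is shown for
      this part and \<open>k\<close> is added back.\<close>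
    have "integrable gauss (\<lambda>z::'a. (affine_ratio (fst p) (snd p) z - 1) * k z)"
    proof (rule integrable_gauss_exp_bound)
      show "\<bar>(affine_ratio (fst p) (snd p) z - 1) * k z\<bar> \<le> K * D * exp (3 / 8 * (norm z)\<^sup>2)" for z
        using K D p by (intro order_trans[OF bd[OF p]] mult_left_le) auto
    qed measurable
    from Bochner_Integration.integrable_add[OF this intk]
    show "integrable gauss (\<lambda>z. affine_ratio (fst p) (snd p) z * k z)"
      by (simp add: algebra_simps)
  next
    show "integrable gauss (\<lambda>z. k z *\<^sub>R (DIM('a) - (norm z)\<^sup>2, z))"
      by (rule integrable_affine_weight[OF assms])
  next
    fix z :: 'a
    show "((\<lambda>p. affine_ratio (fst p) (snd p) z * k z) has_derivative
        (\<lambda>q. k z *\<^sub>R (DIM('a) - (norm z)\<^sup>2, z) \<bullet> q)) (at (1, 0))"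
      using has_derivative_mult_left[OF affine_ratio_has_derivative[of z], of "k z"]
      by (simp add: mult.commute inner_prod_def algebra_simps)
  next
    fix p :: "real \<times> 'a" and z :: 'a assume "norm (p - (1, 0)) < 1 / 24"
    from bd[OF this, of z]
    show "\<bar>affine_ratio (fst p) (snd p) z * k z - affine_ratio (fst (1, 0)) (snd (1, 0)) z * k z\<bar>
        \<le> K * D * exp (3 / 8 * (norm z)\<^sup>2) * norm (p - (1, 0))"
      by (simp add: affine_ratio_def algebra_simps)
  qed (use intB in auto)
qed

section \<open>Gaussian moments\<close>

text \<open>Fubini in coordinates. The factors are complex because they will be characters exp(i s
  x).\<close>

lemma integral_gauss_prod:
  fixes g :: "'a::euclidean_space \<Rightarrow> real \<Rightarrow> complex"
  assumes "\<And>b. b \<in> Basis \<Longrightarrow> integrable std_normal_distribution (g b)"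
  shows "(\<integral>z. (\<Prod>b\<in>Basis. g b (z \<bullet> b)) \<partial>gauss) = (\<Prod>b\<in>Basis. \<integral>x. g b x \<partial>std_normal_distribution)"
proof -
  have [measurable]: "g b \<in> borel_measurable borel" if "b \<in> Basis" for b
    using assms[OF that] by (auto dest: borel_measurable_integrable)
  interpret product_sigma_finite "\<lambda>_::'a. lborel :: real measure" ..
  define G where "G b x = std_normal_density x *\<^sub>R g b x" for b x
  have [measurable]: "G b \<in> borel_measurable borel" if "b \<in> Basis" for b
    unfolding G_def using that by measurable
  have G: "integrable lborel (G b)" if "b \<in> Basis" for b
    unfolding G_def using assms[OF that] that by (subst (asm) integrable_density) auto
  have "(\<integral>z. (\<Prod>b\<in>Basis. g b (z \<bullet> b)) \<partial>gauss)
      = (\<integral>z. gauss_density z *\<^sub>R (\<Prod>b\<in>Basis. g b (z \<bullet> b)) \<partial>lborel)"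
    unfolding gauss_def by (rule integral_density) (auto simp: gauss_density_pos less_imp_le)
  also have "\<dots> = (\<integral>z. (\<Prod>b\<in>Basis. G b (z \<bullet> b)) \<partial>lborel)"
    by (simp add: gauss_density_prod G_def scaleR_conv_of_real prod.distrib)
  also have "\<dots> = (\<integral>x. (\<Prod>b\<in>Basis. G b (x b)) \<partial>(\<Pi>\<^sub>M b\<in>Basis. lborel))"
    by (subst lborel_eq, subst integral_distr) (auto intro!: Bochner_Integration.integral_cong prod.cong)
  also have "\<dots> = (\<Prod>b\<in>Basis. \<integral>x. G b x \<partial>lborel)"
    by (rule product_integral_prod) (use G in auto)
  also have "\<dots> = (\<Prod>b\<in>Basis. \<integral>x. g b x \<partial>std_normal_distribution)"
    by (intro prod.cong refl, subst integral_density) (auto simp: G_def[abs_def])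
  finally show ?thesis .
qed

text \<open>Rotation invariance by way of characteristic functions: the character of u . z splits
  over the coordinates, and the product of the factors depends on u only through |u|.\<close>

lemma distr_gauss_inner:
  fixes u :: "'a::euclidean_space"
  assumes "norm u = 1"
  shows "distr gauss borel (\<lambda>z. u \<bullet> z) = std_normal_distribution"
proof (rule Levy_uniqueness)
  show "real_distribution (distr gauss borel (\<lambda>z. u \<bullet> z))"
    by (rule gauss.real_distribution_distr) auto
  show "real_distribution std_normal_distribution" by (rule real_dist_normal_dist)
  show "char (distr gauss borel (\<lambda>z. u \<bullet> z)) = char std_normal_distribution"
  proof
    fix t :: real
    have int: "integrable std_normal_distribution (\<lambda>x. iexp (s * x))" for s
      using prob_space.integrable_iexp[OF prob_space_normal_density[of 1 0], of "\<lambda>x. s * x"] by simp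
    have "char (distr gauss borel (\<lambda>z. u \<bullet> z)) t = (\<integral>z. iexp (t * (u \<bullet> z)) \<partial>gauss)"
      unfolding char_def by (subst integral_distr) auto
    also have "\<dots> = (\<integral>z. (\<Prod>b\<in>Basis. iexp ((t * (u \<bullet> b)) * (z \<bullet> b))) \<partial>gauss)"
      by (subst euclidean_inner) (simp add: sum_distrib_left exp_sum mult_ac)
    also have "\<dots> = (\<Prod>b\<in>Basis. \<integral>x. iexp ((t * (u \<bullet> b)) * x) \<partial>std_normal_distribution)"
      by (rule integral_gauss_prod) (rule int)
    also have "\<dots> = (\<Prod>b\<in>Basis. char std_normal_distribution (t * (u \<bullet> b)))"
      by (simp add: char_def)
    also have "\<dots> = complex_of_real (\<Prod>b\<in>Basis. exp (- (t * (u \<bullet> b))\<^sup>2 / 2))"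
      by (simp add: char_std_normal_distribution)
    also have "(\<Prod>b\<in>Basis. exp (- (t * (u \<bullet> b))\<^sup>2 / 2)) = exp (- (t\<^sup>2 * (u \<bullet> u)) / 2)"
      using euclidean_inner[of u u]
      by (simp add: exp_sum sum_distrib_left sum_divide_distrib power2_eq_square mult_ac flip: sum_negf)
    also have "\<dots> = exp (- t\<^sup>2 / 2)"
      using assms by (simp add: dot_square_norm)
    finally show "char (distr gauss borel (\<lambda>z. u \<bullet> z)) t = char std_normal_distribution t"
      by (simp add: char_std_normal_distribution)
  qed
qed

lemma integral_gauss_inner:
  fixes u :: "'a::euclidean_space" and g :: "real \<Rightarrow> real"
  assumes "norm u = 1" "g \<in> borel_measurable borel"
  shows "(\<integral>z. g (u \<bullet> z) \<partial>gauss) = (\<integral>x. g x \<partial>std_normal_distribution)"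
  using assms by (subst distr_gauss_inner[symmetric, OF assms(1)], subst integral_distr) auto

lemma integral_gauss_inner_power:
  assumes "norm u = 1"
  shows "(\<integral>z. (u \<bullet> z)\<^sup>2 \<partial>gauss) = 1" "(\<integral>z. (u \<bullet> z) ^ 4 \<partial>gauss) = 3"
  using integral_gauss_inner[OF assms, of "\<lambda>x. x\<^sup>2"] integral_gauss_inner[OF assms, of "\<lambda>x. x ^ 4"]
    std_normal_distribution_even_moments(1)[of 1] std_normal_distribution_even_moments(1)[of 2]
  by (simp_all add: fact_numeral)

text \<open>Since x^2 - 1 has mean zero, the absolute value may be replaced by twice the part
  supported on [-1, 1], where the integral is elementary.\<close>

lemma std_normal_abs_square_minus_one:
  "(\<integral>x. \<bar>x\<^sup>2 - 1\<bar> \<partial>std_normal_distribution) \<le> 1"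
proof -
  let ?N = "std_normal_distribution" and ?\<phi> = std_normal_density
  interpret N: prob_space ?N using prob_space_normal_density[of 1 0] by simp
  have int2: "integrable ?N (\<lambda>x. x\<^sup>2)" by (rule integrable_std_normal_distribution_moment)
  have E2: "(\<integral>x. x\<^sup>2 \<partial>?N) = 1"
    using std_normal_distribution_even_moments(1)[of 1] by (simp add: fact_numeral)
  have intI: "integrable ?N (\<lambda>x. indicator {-1..1} x * (1 - x\<^sup>2))"
  proof (rule N.integrable_const_bound[where B = 1])
    have "\<bar>indicator {-1..1} x * (1 - x\<^sup>2)\<bar> \<le> 1" for x :: real
      using abs_square_le_1[of x] by (cases "\<bar>x\<bar> \<le> 1") (auto simp: indicator_def abs_le_iff)
    then show "AE x in ?N. norm (indicator {-1..1} x * (1 - x\<^sup>2)) \<le> 1" by simp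
  qed simp
  have "(\<integral>x. \<bar>x\<^sup>2 - 1\<bar> \<partial>?N) = (\<integral>x. (x\<^sup>2 - 1) + 2 * (indicator {-1..1} x * (1 - x\<^sup>2)) \<partial>?N)"
  proof (rule Bochner_Integration.integral_cong[OF refl])
    fix x :: real
    show "\<bar>x\<^sup>2 - 1\<bar> = (x\<^sup>2 - 1) + 2 * (indicator {-1..1} x * (1 - x\<^sup>2))"
      using abs_square_le_1[of x] by (auto simp: indicator_def abs_le_iff)
  qed
  also have "\<dots> = 2 * (\<integral>x. indicator {-1..1} x * (1 - x\<^sup>2) \<partial>?N)"
    using int2 intI N.prob_space by (simp add: E2)
  also have "(\<integral>x. indicator {-1..1} x * (1 - x\<^sup>2) \<partial>?N) = (\<integral>x. (?\<phi> x * (1 - x\<^sup>2)) * indicator {-1..1} x \<partial>lborel)"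
    by (subst integral_density) (auto simp: mult_ac)
  \<comment> \<open>By \<phi>'(x) = - x \<phi>(x), the function x \<phi>(x) is an antiderivative of
    \<phi>(x) (1 - x^2).\<close>
  also have "\<dots> = 1 * ?\<phi> 1 - (-1) * ?\<phi> (-1)"
  proof (rule integral_FTC_Icc_real)
    have "((\<lambda>x. x * (c * exp (- x\<^sup>2 / 2))) has_real_derivative c * exp (- x\<^sup>2 / 2) * (1 - x\<^sup>2)) (at x)" for c x :: real
      by (auto intro!: derivative_eq_intros simp: algebra_simps power2_eq_square)
    then show "((\<lambda>x. x * ?\<phi> x) has_real_derivative ?\<phi> x * (1 - x\<^sup>2)) (at x)" for x
      unfolding std_normal_density_def .
    show "isCont (\<lambda>x. ?\<phi> x * (1 - x\<^sup>2)) x" for x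
      unfolding std_normal_density_def by (auto intro!: continuous_intros)
  qed simp
  also have "2 * (1 * ?\<phi> 1 - (-1) * ?\<phi> (-1)) = 4 / (sqrt (2 * pi) * exp (1 / 2))"
    by (simp add: std_normal_density_def exp_minus field_simps)
  also have "\<dots> \<le> 1"
  proof -
    \<comment> \<open>The claim is 16 <= 2 pi e, about 17.08; the rational bounds give 2 * 3.1 * 2.7
      = 16.74.\<close>
    have "(4::real)\<^sup>2 \<le> (2 * pi) * exp 1"
    proof -
      have "(2.7::real) \<le> exp 1" using e_approx_32 by (simp add: abs_if split: if_splits)
      then have "(2 * 3.1) * 2.7 \<le> (2 * pi) * exp 1"
        using pi_approx by (intro mult_mono) auto
      then show ?thesis by simp
    qed
    also have "\<dots> = (sqrt (2 * pi) * exp (1 / 2))\<^sup>2"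
      by (simp add: power_mult_distrib flip: exp_double)
    finally have "4 \<le> sqrt (2 * pi) * exp (1 / 2)"
      by (rule power2_le_imp_le) simp
    then show ?thesis by (simp add: divide_le_eq)
  qed
  finally show ?thesis .
qed

lemma integral_gauss_abs_inner_square:
  assumes "norm u = 1"
  shows "(\<integral>z. \<bar>(u \<bullet> z)\<^sup>2 - 1\<bar> \<partial>gauss) \<le> 1"
  using integral_gauss_inner[OF assms, of "\<lambda>x. \<bar>x\<^sup>2 - 1\<bar>"] std_normal_abs_square_minus_one by simp

lemma integral_gauss_norm_square:
  "(\<integral>z. (norm z)\<^sup>2 \<partial>(gauss :: 'a::euclidean_space measure)) = DIM('a)"
proof -
  have "(\<integral>z. (norm z)\<^sup>2 \<partial>(gauss :: 'a measure)) = (\<integral>z. (\<Sum>b\<in>Basis. (b \<bullet> z)\<^sup>2) \<partial>(gauss :: 'a measure))"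
    by (subst power2_norm_eq_inner, subst euclidean_inner) (simp add: power2_eq_square inner_commute)
  also have "\<dots> = (\<Sum>b\<in>(Basis::'a set). \<integral>z. (b \<bullet> z)\<^sup>2 \<partial>gauss)"
    by (intro Bochner_Integration.integral_sum poly_growth_integrable) auto
  finally show ?thesis by (simp add: integral_gauss_inner_power)
qed

section \<open>A fractional weighted moment and its comparison with Gamma functions\<close>

lemma powr_le_affine:
  fixes a x :: real
  assumes "x \<ge> 0" "0 \<le> a" "a \<le> 1"
  shows "x powr a \<le> 1 + a * (x - 1)"
proof (cases "x = 0")
  case False
  then show ?thesis
    using Youngs_inequality_0[of a "1 - a" x 1] assms by (simp add: algebra_simps)
qed (use assms in auto)

text \<open>The weights in the quadratic bound below are chosen so that the fourth moment suffices;
  the resulting constant \<open>3/2\<close> is smaller than the one the Gamma functions provide.\<close>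

lemma integral_gauss_weight_norm_powr:
  fixes u :: "'a::euclidean_space"
  assumes u: "norm u = 1" and a: "0 < a" "a \<le> 1"
  shows "(\<integral>z. \<bar>(u \<bullet> z)\<^sup>2 - 1\<bar> * norm z powr a \<partial>gauss) \<le> 3 / 2 * DIM('a) powr (a / 2)"
proof -
  define d where "d = real DIM('a)"
  have d: "d > 0" by (simp add: d_def)
  have pw: "poly_growth (\<lambda>z::'a. (u \<bullet> z) ^ n)" "poly_growth (\<lambda>z::'a. norm z ^ n)" for n by auto
  let ?g = "\<lambda>z. d powr (a / 2) * (((u \<bullet> z) ^ 4 - 2 * (u \<bullet> z)\<^sup>2 + 1) / 4 + (1 + a * ((norm z)\<^sup>2 / d - 1)))"
  have bd: "\<bar>(u \<bullet> z)\<^sup>2 - 1\<bar> * norm z powr a \<le> ?g z" for z :: 'a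
  proof -
    define q where "q = \<bar>(u \<bullet> z)\<^sup>2 - 1\<bar>"
    \<comment> \<open>Division by d gives |z|^2 / d mean 1, the point where the affine bound for
      powers is tangent, so the affine bound for r^2 averages to exactly 1.\<close>
    define r where "r = ((norm z)\<^sup>2 / d) powr (a / 2)"
    have "norm z powr a = ((norm z)\<^sup>2) powr (a / 2)"
      by (cases "z = 0") (auto simp: powr_powr simp flip: powr_numeral)
    also have "\<dots> = d powr (a / 2) * r"
      unfolding r_def using d by (subst powr_mult[symmetric]) auto
    finally have eq: "q * norm z powr a = d powr (a / 2) * (q * r)" by simp
    \<comment> \<open>As q^2 has mean 3 - 2 + 1 = 2 and the bound for r^2 has mean 1, this weighting
      yields 1/2 + 1 = 3/2.\<close>
    have "0 \<le> (q / 2 - r)\<^sup>2" by simp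
    then have "q * r \<le> q\<^sup>2 / 4 + r\<^sup>2" by (simp add: power2_eq_square algebra_simps)
    moreover have "r\<^sup>2 \<le> 1 + a * ((norm z)\<^sup>2 / d - 1)"
    proof -
      have "r\<^sup>2 = ((norm z)\<^sup>2 / d) powr a"
        unfolding r_def by (simp add: power2_eq_square flip: powr_add)
      then show ?thesis using powr_le_affine[of "(norm z)\<^sup>2 / d" a] a d by simp
    qed
    moreover have q2: "q\<^sup>2 = (u \<bullet> z) ^ 4 - 2 * (u \<bullet> z)\<^sup>2 + 1"
      by (simp add: q_def power2_eq_square power4_eq_xxxx algebra_simps)
    ultimately have "q * r \<le> q\<^sup>2 / 4 + (1 + a * ((norm z)\<^sup>2 / d - 1))"
      by (meson add_left_mono order_trans)
    then have "q * r \<le> ((u \<bullet> z) ^ 4 - 2 * (u \<bullet> z)\<^sup>2 + 1) / 4 + (1 + a * ((norm z)\<^sup>2 / d - 1))"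
      unfolding q2 .
    then have "d powr (a / 2) * (q * r) \<le> ?g z" by (intro mult_left_mono) auto
    then have "q * norm z powr a \<le> ?g z" unfolding eq .
    then show ?thesis unfolding q_def .
  qed
  have pg: "poly_growth ?g" unfolding divide_inverse by (intro poly_growth_mult poly_growth_add poly_growth_diff pw poly_growth_const)
  have "poly_growth (\<lambda>z. \<bar>(u \<bullet> z)\<^sup>2 - 1\<bar> * norm z powr a)"
    by (rule poly_growth_mono[OF pg]) (use bd in auto)
  then have "(\<integral>z. \<bar>(u \<bullet> z)\<^sup>2 - 1\<bar> * norm z powr a \<partial>gauss) \<le> (\<integral>z. ?g z \<partial>gauss)"
    by (intro integral_mono poly_growth_integrable pg bd)
  also have "\<dots> = d powr (a / 2) * ((3 - 2 * 1 + 1) / 4 + (1 + a * (d / d - 1)))"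
    using pw[of 4, THEN poly_growth_integrable] pw[of 2, THEN poly_growth_integrable] u
    by (simp add: integral_gauss_inner_power integral_gauss_norm_square gauss.prob_space d_def)
  also have "\<dots> = 3 / 2 * d powr (a / 2)" using d by simp
  finally show ?thesis by (simp add: d_def)
qed

text \<open>Wendel's lower bound. Log-convexity is applied at x + 1 = s (x + s) + (1 - s) (x + s +
  1), a point between arguments of Gamma that differ by one, so the functional equation leaves only
  Gamma (x + s) and Gamma x.\<close>

lemma Gamma_ratio_ge:
  fixes x s :: real
  assumes "x > 0" "0 \<le> s" "s \<le> 1"
  shows "x * (x + s) powr (s - 1) \<le> Gamma (x + s) / Gamma x"
proof -
  have pos: "Gamma (x + s) > 0" "Gamma x > 0" "x + s > 0" using assms by (auto intro!: Gamma_real_pos)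
  have conv: "(ln \<circ> Gamma) ((1 - (1 - s)) *\<^sub>R (x + s) + (1 - s) *\<^sub>R (x + s + 1))
      \<le> (1 - (1 - s)) * (ln \<circ> Gamma) (x + s) + (1 - s) * (ln \<circ> Gamma) (x + s + 1)"
    using assms by (intro convex_onD[OF log_convex_Gamma_real]) auto
  have eq: "(1 - (1 - s)) *\<^sub>R (x + s) + (1 - s) *\<^sub>R (x + s + 1) = x + 1"
    by (simp add: algebra_simps)
  have "x + s \<notin> \<int>\<^sub>\<le>\<^sub>0" using pos(3) by (auto elim!: nonpos_Ints_cases)
  then have G: "ln (Gamma (x + s + 1)) = ln (x + s) + ln (Gamma (x + s))"
    using Gamma_plus1[of "x + s"] ln_mult_pos[OF pos(3,1)] by simp
  have "ln (Gamma (x + 1)) \<le> ln (Gamma (x + s)) + (1 - s) * ln (x + s)"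
    using conv unfolding eq o_def G by (simp add: algebra_simps)
  also have "Gamma (x + 1) = x * Gamma x"
    using assms by (subst Gamma_plus1) (auto simp: nonpos_Ints_def)
  finally have "ln (x * Gamma x * (x + s) powr (s - 1)) \<le> ln (Gamma (x + s))"
    using less_imp_neq[OF pos(2)] pos(3) assms by (simp add: ln_mult ln_powr algebra_simps)
  then have "x * Gamma x * (x + s) powr (s - 1) \<le> Gamma (x + s)"
    using pos assms by (subst (asm) ln_le_cancel_iff) auto
  then show ?thesis using pos by (simp add: le_divide_eq mult_ac)
qed

text \<open>\<open>C1\<close> is 2/a times E[((u . Z)^2 + 1) |Z|^a], the triangle-inequality bound
  for the moment E[|(u . Z)^2 - 1| |Z|^a]. The comparison with 3/2 d^(a/2) reaches that constant
  without evaluating a fractional moment of |Z|.\<close>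

lemma C1_ge:
  assumes "0 < a" "a \<le> 1" "d \<ge> 1"
  shows "3 / 2 * real d powr (a / 2) \<le> a / 2 * C1 a d"
proof -
  define x where "x = real d / 2"
  define s where "s = a / 2"
  define e where "e = s / x"
  have x: "x > 0" "x \<ge> 1 / 2" and s: "0 < s" "s \<le> 1 / 2" using assms by (auto simp: x_def s_def)
  have e: "0 < e" "e \<le> 1" using x s by (auto simp: e_def)
  \<comment> \<open>Here e = a / d <= 1, and (2 + e) / (1 + e) decreases to 3/2 at e = 1, that is at
    a = d = 1.\<close>
  have "3 / 2 \<le> (2 + e) * (1 + e) powr (-1)"
    using e by (simp add: powr_minus field_simps)
  also have "\<dots> \<le> (2 + e) * (1 + e) powr (s - 1)"
    using e s by (intro mult_left_mono powr_mono) auto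
  finally have "3 / 2 * (2 * x) powr s \<le> (2 + e) * (1 + e) powr (s - 1) * (2 * x) powr s"
    by (intro mult_right_mono) auto
  also have "\<dots> = (2 + e) * 2 powr s * (x * (x * (1 + e)) powr (s - 1))"
  proof -
    have "(2 * x) powr s = 2 powr s * x powr s" "(x * (1 + e)) powr (s - 1) = x powr (s - 1) * (1 + e) powr (s - 1)"
      using x e by (auto simp: powr_mult)
    moreover have "x * x powr (s - 1) = x powr s" using x by (simp add: powr_diff)
    ultimately show ?thesis by (simp add: mult_ac)
  qed
  also have "x * (1 + e) = x + s" using x by (simp add: e_def field_simps)
  also have "(2 + e) * 2 powr s * (x * (x + s) powr (s - 1)) \<le> (2 + e) * 2 powr s * (Gamma (x + s) / Gamma x)"
    using x s e by (intro mult_left_mono Gamma_ratio_ge) auto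
  also have "\<dots> = a / 2 * C1 a d"
  proof -
    have "(a + real d) / 2 = x + s" "real d / 2 = x" by (auto simp: x_def s_def field_simps)
    moreover have "a / 2 * (2 powr (a / 2 + 1) * ((a + 2 * real d) / (a * real d))) = (2 + e) * 2 powr s"
      using assms unfolding powr_add by (simp add: e_def s_def x_def field_simps)
    ultimately show ?thesis unfolding C1_def by (metis mult.assoc)
  qed
  finally show ?thesis by (simp add: x_def s_def)
qed

section \<open>Gaussian averages of Hoelder functions\<close>

lemma affine_gauss_integral_has_derivative_components:
  fixes k :: "'a::euclidean_space \<Rightarrow> real"
  assumes "poly_growth k"
  shows "((\<lambda>p. \<integral>z. affine_ratio (fst p) (snd p) z * k z \<partial>gauss) has_derivative
    (\<lambda>q. (\<integral>z. k z * (DIM('a) - (norm z)\<^sup>2) \<partial>gauss) * fst q + (\<integral>z. k z *\<^sub>R z \<partial>gauss) \<bullet> snd q)) (at (1, 0))"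
proof -
  note i = integrable_affine_weight[OF assms]
  have "(\<integral>z. k z *\<^sub>R (DIM('a) - (norm z)\<^sup>2, z) \<partial>gauss) =
      (\<integral>z. k z * (DIM('a) - (norm z)\<^sup>2) \<partial>gauss, \<integral>z. k z *\<^sub>R z \<partial>gauss)"
    using integral_bounded_linear[OF bounded_linear_fst i] integral_bounded_linear[OF bounded_linear_snd i]
    by (simp add: prod_eq_iff)
  with affine_gauss_integral_has_derivative[OF assms] show ?thesis
    by (simp add: inner_prod_def)
qed

text \<open>Gaussian integration by parts without a derivative of \<open>k\<close>: with b = 1 the
  shift sits in the density, whose derivative in v is z.\<close>

lemma shift_has_derivative:
  fixes k :: "'a::euclidean_space \<Rightarrow> real"
  assumes "poly_growth k"
  shows "((\<lambda>v. \<integral>z. k (z + v) \<partial>gauss) has_derivative (\<lambda>w. (\<integral>z. k z *\<^sub>R z \<partial>gauss) \<bullet> w)) (at 0)"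
proof -
  have "(\<integral>z. k (z + v) \<partial>gauss) = (\<integral>z. affine_ratio 1 v z * k z \<partial>gauss)" for v
    using integral_gauss_affine[of 1 k v] poly_growthD[OF assms] by simp
  moreover have "((\<lambda>v::'a. (1::real, v)) has_derivative (\<lambda>w. (0, w))) (at 0)"
    by (auto intro!: derivative_eq_intros)
  from has_derivative_compose[OF this, OF affine_gauss_integral_has_derivative_components[OF assms]]
  have "((\<lambda>v. \<integral>z. affine_ratio 1 v z * k z \<partial>gauss) has_derivative (\<lambda>w. (\<integral>z. k z *\<^sub>R z \<partial>gauss) \<bullet> w)) (at 0)"
    by simp
  ultimately show ?thesis by simp
qed

lemma poly_growth_translate:
  assumes "poly_growth k"
  shows "poly_growth (\<lambda>z. k (z + v))"
proof -
  obtain C m where C: "\<And>z. \<bar>k z\<bar> \<le> C * (1 + norm z) ^ m"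
    using assms by (auto simp: poly_growth_def)
  note [measurable] = poly_growthD[OF assms]
  show ?thesis
  proof (rule poly_growth_mono[where g = "\<lambda>z. \<bar>C\<bar> * (1 + norm v + norm z) ^ m"])
    show "\<bar>k (z + v)\<bar> \<le> \<bar>C\<bar> * (1 + norm v + norm z) ^ m" for z
      using norm_triangle_ineq[of z v]
      by (intro order_trans[OF C] mult_mono power_mono) auto
  qed (auto intro!: poly_growth_mult poly_growth_power poly_growth_add)
qed

lemma integrable_gauss_scaleR_id [intro]:
  fixes k :: "'a::euclidean_space \<Rightarrow> real"
  shows "poly_growth k \<Longrightarrow> integrable gauss (\<lambda>z. k z *\<^sub>R z)"
  by (rule poly_growth_integrable_scaleR) auto

lemma integrable_gauss_hermite:
  fixes k :: "'a::euclidean_space \<Rightarrow> real"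
  assumes "poly_growth k"
  shows "integrable gauss (\<lambda>z. k z *\<^sub>R ((a \<bullet> z) *\<^sub>R z - a))"
  unfolding scaleR_diff_right scaleR_scaleR
  by (intro Bochner_Integration.integrable_diff integrable_scaleR_left integrable_gauss_scaleR_id
      poly_growth_mult poly_growth_integrable assms) auto

text \<open>Writing a . z = a . (z + v) - a . v reduces the weighted average to two unweighted ones;
  the product rule for the second produces the correction - a of the second Hermite weight.\<close>

lemma shift_weighted_has_derivative:
  fixes k :: "'a::euclidean_space \<Rightarrow> real"
  assumes "poly_growth k"
  shows "((\<lambda>v. \<integral>z. k (z + v) * (a \<bullet> z) \<partial>gauss) has_derivative
    (\<lambda>w. (\<integral>z. k z *\<^sub>R ((a \<bullet> z) *\<^sub>R z - a) \<partial>gauss) \<bullet> w)) (at 0)"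
proof -
  let ?k = "\<lambda>z. k z * (a \<bullet> z)"
  have k: "poly_growth ?k" using assms by auto
  have "(\<integral>z. k (z + v) * (a \<bullet> z) \<partial>gauss) = (\<integral>z. ?k (z + v) \<partial>gauss) - (a \<bullet> v) * (\<integral>z. k (z + v) \<partial>gauss)" for v
  proof -
    have "(\<integral>z. ?k (z + v) \<partial>gauss) - (a \<bullet> v) * (\<integral>z. k (z + v) \<partial>gauss) =
       (\<integral>z. ?k (z + v) - (a \<bullet> v) * k (z + v) \<partial>gauss)"
      using poly_growth_integrable[OF poly_growth_translate[OF k, of v]]
        poly_growth_integrable[OF poly_growth_translate[OF assms, of v]] by simp
    also have "\<dots> = (\<integral>z. k (z + v) * (a \<bullet> z) \<partial>gauss)"
      by (simp add: inner_add_right algebra_simps)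
    finally show ?thesis by simp
  qed
  moreover have "(\<integral>z. k z *\<^sub>R ((a \<bullet> z) *\<^sub>R z - a) \<partial>gauss) =
      (\<integral>z. ?k z *\<^sub>R z \<partial>gauss) - (\<integral>z. k z \<partial>gauss) *\<^sub>R a"
    unfolding scaleR_diff_right scaleR_scaleR
    using integrable_gauss_scaleR_id[OF k] poly_growth_integrable[OF assms] by simp
  moreover have "((\<lambda>v. (\<integral>z. ?k (z + v) \<partial>gauss) - (a \<bullet> v) * (\<integral>z. k (z + v) \<partial>gauss)) has_derivative
     (\<lambda>w. ((\<integral>z. ?k z *\<^sub>R z \<partial>gauss) - (\<integral>z. k z \<partial>gauss) *\<^sub>R a) \<bullet> w)) (at 0)"
    by (rule derivative_eq_intros shift_has_derivative k assms refl)+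
       (simp add: inner_diff_left mult.commute)
  ultimately show ?thesis by simp
qed

lemma has_derivative_inner_constD:
  fixes m :: "'a::euclidean_space"
  assumes "((\<lambda>_. c :: real) has_derivative (\<lambda>w. m \<bullet> w)) (at x)"
  shows "m = 0"
proof -
  have "(\<lambda>w. m \<bullet> w) = (\<lambda>w. 0)"
    using has_derivative_unique[OF assms has_derivative_const] .
  then have "m \<bullet> m = 0" by metis
  then show ?thesis by simp
qed

text \<open>Both means vanish because the averages of the shifted constant function do not depend on the shift.\<close>

lemma integral_gauss_id: "(\<integral>z. z \<partial>gauss) = 0"
  using shift_has_derivative[of "\<lambda>_. 1"] by (auto dest: has_derivative_inner_constD)

lemma integral_gauss_hermite: "(\<integral>z. ((a \<bullet> z) *\<^sub>R z - a) \<partial>gauss) = 0"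
  using shift_weighted_has_derivative[of "\<lambda>_. 1" a] by (auto dest: has_derivative_inner_constD)

lemma powr_le_1_plus: "r powr a \<le> 1 + r" if "r \<ge> 0" "0 \<le> a" "a \<le> 1" for r a :: real
proof -
  have "r powr a \<le> 1 + a * (r - 1)" using powr_le_affine that by simp
  also have "\<dots> \<le> 1 + r" using that mult_right_mono[of a 1 r] by (simp add: algebra_simps)
  finally show ?thesis .
qed

text \<open>A real constant \<open>L\<close> stands for the seminorm, so that the extended-valued
  supremum is met only in the final theorem.\<close>

locale holder_function =
  fixes h :: "'a::euclidean_space \<Rightarrow> real" and \<alpha> L :: real
  assumes alpha: "0 < \<alpha>" "\<alpha> \<le> 1" and L_nonneg: "L \<ge> 0"
    and holder: "\<And>x y. \<bar>h x - h y\<bar> \<le> L * norm (x - y) powr \<alpha>"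
begin

lemma continuous_h: "continuous_on A h"
proof -
  have "(h \<longlongrightarrow> h x) (at x)" for x
  proof (rule Lim_null_comparison[THEN LIM_zero_cancel])
    show "\<forall>\<^sub>F y in at x. norm (h y - h x) \<le> L * norm (y - x) powr \<alpha>"
      using holder by simp
    have "((\<lambda>y. L * norm (y - x) powr \<alpha>) \<longlongrightarrow> L * norm (x - x) powr \<alpha>) (at x)"
      by (intro tendsto_intros tendsto_powr') (use alpha in auto)
    then show "((\<lambda>y. L * norm (y - x) powr \<alpha>) \<longlongrightarrow> 0) (at x)" by simp
  qed
  then show ?thesis
    by (simp add: continuous_at_imp_continuous_on isCont_def)
qed

lemma measurable_h [measurable]: "h \<in> borel_measurable borel"
  by (rule borel_measurable_continuous_onI[OF continuous_h])

lemma abs_h_le: "\<bar>h (y + z)\<bar> \<le> \<bar>h y\<bar> + L * (1 + norm z)"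
proof -
  have "\<bar>h (y + z) - h y\<bar> \<le> L * norm z powr \<alpha>"
    using holder[of "y + z" y] by simp
  also have "\<dots> \<le> L * (1 + norm z)"
    using alpha L_nonneg by (intro mult_left_mono powr_le_1_plus) auto
  finally show ?thesis by linarith
qed

lemma poly_growth_h [intro, simp]: "poly_growth (\<lambda>z. h (y + s *\<^sub>R z))"
proof (rule poly_growth_mono[where g = "\<lambda>z. \<bar>h y\<bar> + L * (1 + \<bar>s\<bar> * norm z)"])
  show "\<bar>h (y + s *\<^sub>R z)\<bar> \<le> \<bar>h y\<bar> + L * (1 + \<bar>s\<bar> * norm z)" for z
    using abs_h_le[of y "s *\<^sub>R z"] by simp
qed (auto intro!: poly_growth_add poly_growth_mult)

text \<open>Moving y by w has the same effect as moving z by w / s, which turns the derivative in y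
  into the derivative in the shift and accounts for the factor 1 / s.\<close>

lemma gauss_average_has_derivative:
  assumes "s > 0"
  shows "((\<lambda>y. \<integral>z. h (y + s *\<^sub>R z) \<partial>gauss) has_derivative
    (\<lambda>w. ((\<integral>z. h (y + s *\<^sub>R z) *\<^sub>R z \<partial>gauss) /\<^sub>R s) \<bullet> w)) (at y)"
proof -
  let ?k = "\<lambda>z. h (y + s *\<^sub>R z)"
  have "((\<lambda>y'. (y' - y) /\<^sub>R s) has_derivative (\<lambda>w. w /\<^sub>R s)) (at y)"
    by (auto intro!: derivative_eq_intros)
  moreover have "((\<lambda>v. \<integral>z. ?k (z + v) \<partial>gauss) has_derivative (\<lambda>w. (\<integral>z. ?k z *\<^sub>R z \<partial>gauss) \<bullet> w)) (at ((y - y) /\<^sub>R s))"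
    using shift_has_derivative[of ?k] by simp
  ultimately have "((\<lambda>y'. \<integral>z. ?k (z + (y' - y) /\<^sub>R s) \<partial>gauss) has_derivative
      (\<lambda>w. (\<integral>z. ?k z *\<^sub>R z \<partial>gauss) \<bullet> (w /\<^sub>R s))) (at y)"
    by (rule has_derivative_compose)
  with assms show ?thesis by (simp add: algebra_simps)
qed

lemma gauss_average_weighted_has_derivative:
  assumes "s > 0"
  shows "((\<lambda>y. \<integral>z. h (y + s *\<^sub>R z) * (a \<bullet> z) \<partial>gauss) has_derivative
    (\<lambda>w. ((\<integral>z. h (y + s *\<^sub>R z) *\<^sub>R ((a \<bullet> z) *\<^sub>R z - a) \<partial>gauss) /\<^sub>R s) \<bullet> w)) (at y)"
proof -
  let ?k = "\<lambda>z. h (y + s *\<^sub>R z)" and ?p = "\<lambda>z. (a \<bullet> z) *\<^sub>R z - a"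
  have "((\<lambda>y'. (y' - y) /\<^sub>R s) has_derivative (\<lambda>w. w /\<^sub>R s)) (at y)"
    by (auto intro!: derivative_eq_intros)
  moreover have "((\<lambda>v. \<integral>z. ?k (z + v) * (a \<bullet> z) \<partial>gauss) has_derivative
      (\<lambda>w. (\<integral>z. ?k z *\<^sub>R ?p z \<partial>gauss) \<bullet> w)) (at ((y - y) /\<^sub>R s))"
    using shift_weighted_has_derivative[of ?k] by simp
  ultimately have "((\<lambda>y'. \<integral>z. ?k (z + (y' - y) /\<^sub>R s) * (a \<bullet> z) \<partial>gauss) has_derivative
      (\<lambda>w. (\<integral>z. ?k z *\<^sub>R ?p z \<partial>gauss) \<bullet> (w /\<^sub>R s))) (at y)"
    by (rule has_derivative_compose)
  with assms show ?thesis by (simp add: algebra_simps)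
qed

text \<open>\<open>grad_kernel\<close> and \<open>hess_kernel\<close> are the first two \<open>x\<close>-derivatives of \<open>interp t x / (2 t)\<close>, in a form
  in which only the Gaussian weight has been differentiated.\<close>

definition interp :: "real \<Rightarrow> 'a \<Rightarrow> real" where
  "interp t x = (\<integral>z. h (sqrt t *\<^sub>R x + sqrt (1 - t) *\<^sub>R z) \<partial>gauss)"

definition grad_kernel :: "real \<Rightarrow> 'a \<Rightarrow> 'a" where
  "grad_kernel t x = (1 / (2 * sqrt t * sqrt (1 - t))) *\<^sub>R
     (\<integral>z. h (sqrt t *\<^sub>R x + sqrt (1 - t) *\<^sub>R z) *\<^sub>R z \<partial>gauss)"

definition hess_kernel :: "real \<Rightarrow> 'a \<Rightarrow> 'a \<Rightarrow> 'a" where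
  "hess_kernel t x a = (1 / (2 * (1 - t))) *\<^sub>R
     (\<integral>z. h (sqrt t *\<^sub>R x + sqrt (1 - t) *\<^sub>R z) *\<^sub>R ((a \<bullet> z) *\<^sub>R z - a) \<partial>gauss)"

lemma interp_has_derivative:
  assumes "0 < t" "t < 1"
  shows "((\<lambda>x. interp t x / (2 * t)) has_derivative (\<lambda>w. grad_kernel t x \<bullet> w)) (at x)"
proof -
  have "((\<lambda>x. sqrt t *\<^sub>R x) has_derivative (\<lambda>w. sqrt t *\<^sub>R w)) (at x)"
    by (auto intro!: derivative_eq_intros)
  from has_derivative_compose[OF this gauss_average_has_derivative[of "sqrt (1 - t)" "sqrt t *\<^sub>R x"]] assms
  have "((\<lambda>x. interp t x) has_derivative (\<lambda>w. ((\<integral>z. h (sqrt t *\<^sub>R x + sqrt (1 - t) *\<^sub>R z) *\<^sub>R z \<partial>gauss)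
     /\<^sub>R sqrt (1 - t)) \<bullet> (sqrt t *\<^sub>R w))) (at x)"
    by (simp add: interp_def)
  then have "((\<lambda>x. 1 / (2 * t) * interp t x) has_derivative (\<lambda>w. 1 / (2 * t) *
      (((\<integral>z. h (sqrt t *\<^sub>R x + sqrt (1 - t) *\<^sub>R z) *\<^sub>R z \<partial>gauss) /\<^sub>R sqrt (1 - t)) \<bullet> (sqrt t *\<^sub>R w)))) (at x)"
    by (rule has_derivative_mult_right)
  moreover have "sqrt t * c / (t * (2 * sqrt (1 - t))) = c / (sqrt t * (2 * sqrt (1 - t)))" for c
    using assms by (simp add: field_simps)
  ultimately show ?thesis
    by (simp add: grad_kernel_def field_simps)
qed

text \<open>Each space derivative brings sqrt t / sqrt (1 - t). After two of them the factor 1 / t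
  of the definition has cancelled, and only t = 1 remains singular.\<close>

lemma grad_kernel_has_derivative:
  assumes "0 < t" "t < 1"
  shows "((\<lambda>x. grad_kernel t x \<bullet> a) has_derivative (\<lambda>w. hess_kernel t x a \<bullet> w)) (at x)"
proof -
  let ?Y = "\<lambda>x z. h (sqrt t *\<^sub>R x + sqrt (1 - t) *\<^sub>R z)"
  have "((\<lambda>x. sqrt t *\<^sub>R x) has_derivative (\<lambda>w. sqrt t *\<^sub>R w)) (at x)"
    by (auto intro!: derivative_eq_intros)
  from has_derivative_compose[OF this gauss_average_weighted_has_derivative[of "sqrt (1 - t)" a "sqrt t *\<^sub>R x"]] assms
  have "((\<lambda>x. \<integral>z. ?Y x z * (a \<bullet> z) \<partial>gauss) has_derivative (\<lambda>w. ((\<integral>z. ?Y x z *\<^sub>R ((a \<bullet> z) *\<^sub>R z - a) \<partial>gauss)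
     /\<^sub>R sqrt (1 - t)) \<bullet> (sqrt t *\<^sub>R w))) (at x)"
    by simp
  moreover have "(\<integral>z. ?Y x z *\<^sub>R z \<partial>gauss) \<bullet> a = (\<integral>z. ?Y x z * (a \<bullet> z) \<partial>gauss)" for x
    by (subst integral_inner_left[symmetric]) (auto simp: inner_commute)
  ultimately have "((\<lambda>x. (1 / (2 * sqrt t * sqrt (1 - t))) * ((\<integral>z. ?Y x z *\<^sub>R z \<partial>gauss) \<bullet> a)) has_derivative
    (\<lambda>w. (1 / (2 * sqrt t * sqrt (1 - t))) * (((\<integral>z. ?Y x z *\<^sub>R ((a \<bullet> z) *\<^sub>R z - a) \<partial>gauss)
     /\<^sub>R sqrt (1 - t)) \<bullet> (sqrt t *\<^sub>R w)))) (at x)"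
    by (intro has_derivative_mult_right) simp
  then show ?thesis
    using assms by (simp add: grad_kernel_def hess_kernel_def field_simps)
qed

end

section \<open>The solution of the Stein equation\<close>

text \<open>The open interval, because the kernels are singular at the end points and their
  derivatives are available only for 0 < t < 1.\<close>

abbreviation unit_lborel :: "real measure" where
  "unit_lborel \<equiv> restrict_space lborel {0<..<1}"

text \<open>For a nonnegative function gauge integrability is absolute, hence Lebesgue,
  integrability; the reflection t -> 1 - t gives the second power.\<close>

lemma integrable_unit_powr:
  assumes "a > -1"
  shows "integrable unit_lborel (\<lambda>t. t powr a)" "integrable unit_lborel (\<lambda>t. (1 - t) powr a)"
proof -
  have i: "(\<lambda>t. t powr a) integrable_on {0..1::real}"
    using integrable_on_powr_from_0[OF assms, of 1] by simp
  then have "(\<lambda>t. t powr a) integrable_on (cbox 0 1)" by simp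
  from integrable_affinity[OF this, of "-1" 1]
  have i': "(\<lambda>t. (1 - t) powr a) integrable_on {0..1::real}" by simp
  have *: "integrable unit_lborel f" if "f integrable_on {0..1}" "f \<in> borel_measurable borel" "\<And>t. f t \<ge> 0" for f :: "real \<Rightarrow> real"
  proof -
    have "f absolutely_integrable_on {0..1}"
      using that(1,3) by (rule nonnegative_absolutely_integrable_1)
    then have "f absolutely_integrable_on {0<..<1}"
      by (simp only: absolutely_integrable_on_Icc_iff_Ioo)
    then show ?thesis
      using that(2) unfolding set_integrable_def
      by (subst (asm) integrable_completion) (auto simp: integrable_restrict_space)
  qed
  show "integrable unit_lborel (\<lambda>t. t powr a)" "integrable unit_lborel (\<lambda>t. (1 - t) powr a)"
    using i i' by (auto intro!: *)
qed

context holder_function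
begin

abbreviation pt :: "real \<Rightarrow> 'a \<Rightarrow> 'a \<Rightarrow> 'a" where
  "pt t x z \<equiv> sqrt t *\<^sub>R x + sqrt (1 - t) *\<^sub>R z"

lemma hess_kernel_inner:
  "hess_kernel t x a \<bullet> b = (\<integral>z. h (pt t x z) * ((a \<bullet> z) * (b \<bullet> z) - a \<bullet> b) \<partial>gauss) / (2 * (1 - t))"
proof -
  have "integrable gauss (\<lambda>z. h (pt t x z) *\<^sub>R ((a \<bullet> z) *\<^sub>R z - a))"
    by (intro integrable_gauss_hermite poly_growth_h)
  then have "(\<integral>z. h (pt t x z) *\<^sub>R ((a \<bullet> z) *\<^sub>R z - a) \<partial>gauss) \<bullet> b
      = (\<integral>z. h (pt t x z) * ((a \<bullet> z) * (b \<bullet> z) - a \<bullet> b) \<partial>gauss)"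
    by (subst integral_inner_left[symmetric]) (simp_all add: inner_diff_left inner_commute[of b])
  then show ?thesis by (simp add: hess_kernel_def)
qed

text \<open>Near a base time t the whole dependence on time is moved into the density ratio. Its
  dilation part, with weight d - |z|^2, yields minus the trace of the Hessian kernel, and its shift
  part yields the gradient kernel along x.\<close>

lemma interp_has_time_derivative:
  assumes t: "0 < t" "t < 1"
  shows "((\<lambda>t. interp t x) has_real_derivative
    (grad_kernel t x \<bullet> x - (\<Sum>b\<in>Basis. hess_kernel t x b \<bullet> b))) (at t)"
proof -
  let ?k = "\<lambda>z. h (pt t x z)" and ?r = "sqrt (1 - t)"
  \<comment> \<open>The pair (b, v) for which z / b + v, inserted at time t, gives the point of time
    t'. At t' = t it is (1, 0), where the derivative of the average is known.\<close>
  define p where "p t' = (?r / sqrt (1 - t'), ((sqrt t' - sqrt t) / ?r) *\<^sub>R x)" for t'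
  define I1 where "I1 = (\<integral>z. ?k z * (DIM('a) - (norm z)\<^sup>2) \<partial>gauss)"
  define I2 where "I2 = (\<integral>z. ?k z *\<^sub>R z \<partial>gauss)"
  have r: "?r > 0" "?r * ?r = 1 - t" using t by auto
  have "((\<lambda>t'. ?r / sqrt (1 - t')) has_real_derivative 1 / (2 * (1 - t))) (at t)"
    using t by (auto intro!: derivative_eq_intros simp: field_simps)
  moreover have "((\<lambda>t'. (sqrt t' - sqrt t) / ?r) has_real_derivative 1 / (2 * sqrt t * ?r)) (at t)"
    using t by (auto intro!: derivative_eq_intros simp: field_simps)
  ultimately have p': "(p has_derivative (\<lambda>s. (1 / (2 * (1 - t)) * s, (1 / (2 * sqrt t * ?r) * s) *\<^sub>R x))) (at t)"
    unfolding p_def has_field_derivative_def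
    by (rule has_derivative_Pair[OF _ has_derivative_scaleR_left])
  have p: "p t = (1, 0)" using r by (simp add: p_def)
  have "((\<lambda>t'. \<integral>z. affine_ratio (fst (p t')) (snd (p t')) z * ?k z \<partial>gauss) has_derivative
     (\<lambda>s. I1 * (1 / (2 * (1 - t)) * s) + I2 \<bullet> ((1 / (2 * sqrt t * ?r) * s) *\<^sub>R x))) (at t)"
    using has_derivative_compose[OF p', of _ _, unfolded p,
      OF affine_gauss_integral_has_derivative_components[of ?k, folded I1_def I2_def]] by simp
  then have der: "((\<lambda>t'. interp t' x) has_derivative
     (\<lambda>s. I1 * (1 / (2 * (1 - t)) * s) + I2 \<bullet> ((1 / (2 * sqrt t * ?r) * s) *\<^sub>R x))) (at t)"
  proof (rule has_derivative_transform_within_open[where s = "{0<..<1}"])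
    fix t' :: real assume t': "t' \<in> {0<..<1}"
    have "(\<integral>z. affine_ratio (fst (p t')) (snd (p t')) z * ?k z \<partial>gauss)
        = (\<integral>z. ?k (z /\<^sub>R (?r / sqrt (1 - t')) + ((sqrt t' - sqrt t) / ?r) *\<^sub>R x) \<partial>gauss)"
      unfolding p_def fst_conv snd_conv by (rule integral_gauss_affine[symmetric]) (use t' r in auto)
    also have "\<dots> = interp t' x"
    proof -
      have "pt t x (z /\<^sub>R (?r / sqrt (1 - t')) + ((sqrt t' - sqrt t) / ?r) *\<^sub>R x) = pt t' x z" for z
        using r by (simp add: scaleR_add_right scaleR_diff_left)
      then show ?thesis unfolding interp_def by simp
    qed
    finally show "(\<integral>z. affine_ratio (fst (p t')) (snd (p t')) z * ?k z \<partial>gauss) = interp t' x" .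
  qed (use t in auto)
  have e2: "I2 \<bullet> ((1 / (2 * sqrt t * ?r) * s) *\<^sub>R x) = (grad_kernel t x \<bullet> x) * s" for s
    by (simp add: grad_kernel_def I2_def)
  \<comment> \<open>Summed over an orthonormal basis the weights (b . z)^2 - 1 give |z|^2 - d, the
    dilation weight with the opposite sign.\<close>
  have e1: "I1 * (1 / (2 * (1 - t)) * s) = - (\<Sum>b\<in>Basis. hess_kernel t x b \<bullet> b) * s" for s
  proof -
    have "(\<Sum>b\<in>Basis. hess_kernel t x b \<bullet> b) =
        (\<Sum>b\<in>Basis. \<integral>z. ?k z * ((b \<bullet> z) * (b \<bullet> z) - 1) \<partial>gauss) / (2 * (1 - t))"
      by (simp add: hess_kernel_inner sum_divide_distrib)
    also have "(\<Sum>b\<in>Basis. \<integral>z. ?k z * ((b \<bullet> z) * (b \<bullet> z) - 1) \<partial>gauss)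
        = (\<integral>z. (\<Sum>b\<in>Basis. ?k z * ((b \<bullet> z) * (b \<bullet> z) - 1)) \<partial>gauss)"
      by (rule Bochner_Integration.integral_sum[symmetric])
         (intro poly_growth_integrable poly_growth_mult poly_growth_diff poly_growth_h poly_growth_inner poly_growth_const)
    also have "\<dots> = (\<integral>z. - (?k z * (DIM('a) - (norm z)\<^sup>2)) \<partial>gauss)"
    proof (rule Bochner_Integration.integral_cong[OF refl])
      fix z :: 'a
      have "(norm z)\<^sup>2 = (\<Sum>b\<in>Basis. (b \<bullet> z) * (b \<bullet> z))"
        by (subst power2_norm_eq_inner, subst euclidean_inner) (simp add: inner_commute)
      then show "(\<Sum>b\<in>Basis. ?k z * ((b \<bullet> z) * (b \<bullet> z) - 1)) = - (?k z * (DIM('a) - (norm z)\<^sup>2))"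
        by (simp add: sum_subtractf right_diff_distrib flip: sum_distrib_left)
    qed
    finally show ?thesis by (simp add: I1_def)
  qed
  show ?thesis
    unfolding has_field_derivative_def
    by (rule has_derivative_eq_rhs[OF der], rule ext, unfold e1 e2) (simp add: left_diff_distrib)
qed

section \<open>Size of the kernels near the end points of the time interval\<close>

lemma holder_pt:
  assumes "0 \<le> t" "t \<le> 1"
  shows "\<bar>h (pt t x z) - h (sqrt t *\<^sub>R x)\<bar> \<le> L * (1 - t) powr (\<alpha> / 2) * norm z powr \<alpha>"
proof -
  have "\<bar>h (pt t x z) - h (sqrt t *\<^sub>R x)\<bar> \<le> L * (sqrt (1 - t) * norm z) powr \<alpha>"
    using holder[of "pt t x z" "sqrt t *\<^sub>R x"] assms by simp
  also have "(sqrt (1 - t) * norm z) powr \<alpha> = (1 - t) powr (\<alpha> / 2) * norm z powr \<alpha>"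
    using assms by (simp add: powr_mult powr_powr flip: powr_half_sqrt)
  finally show ?thesis by (simp add: mult.assoc)
qed

lemma poly_growth_norm_powr: "poly_growth (\<lambda>z::'a. norm z powr \<alpha>)"
  by (rule poly_growth_mono[where g = "\<lambda>z. 1 + norm z"]) (use powr_le_1_plus alpha in auto)

text \<open>The value of \<open>h\<close> at sqrt t x may be subtracted because \<open>p\<close> has
  mean zero. The weight takes values in a Banach space so that one statement covers z, the vector
  Hermite weight and the scalar (u . z)^2 - 1.\<close>

lemma centered_kernel_le:
  fixes p :: "'a \<Rightarrow> 'b::{banach,second_countable_topology}"
  assumes t: "0 \<le> t" "t \<le> 1"
    and p: "p \<in> borel_measurable borel" "poly_growth (\<lambda>z. norm (p z))" "(\<integral>z. p z \<partial>gauss) = 0"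
  shows "norm (\<integral>z. h (pt t x z) *\<^sub>R p z \<partial>gauss)
    \<le> L * (1 - t) powr (\<alpha> / 2) * (\<integral>z. norm z powr \<alpha> * norm (p z) \<partial>gauss)"
proof -
  let ?c = "L * (1 - t) powr (\<alpha> / 2)"
  have 1: "integrable gauss (\<lambda>z. h (pt t x z) *\<^sub>R p z)"
    by (intro poly_growth_integrable_scaleR p poly_growth_h)
  have 2: "integrable gauss p"
    using poly_growth_integrable_scaleR[OF poly_growth_const p(1,2), of 1] by simp
  have 3: "integrable gauss (\<lambda>z. norm z powr \<alpha> * norm (p z))"
    by (intro poly_growth_integrable poly_growth_mult poly_growth_norm_powr p)
  have "(\<integral>z. h (pt t x z) *\<^sub>R p z \<partial>gauss) = (\<integral>z. h (pt t x z) *\<^sub>R p z - h (sqrt t *\<^sub>R x) *\<^sub>R p z \<partial>gauss)"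
    using 1 2 p(3) by simp
  also have "\<dots> = (\<integral>z. (h (pt t x z) - h (sqrt t *\<^sub>R x)) *\<^sub>R p z \<partial>gauss)"
    by (simp add: scaleR_diff_left)
  also have "norm \<dots> \<le> (\<integral>z. ?c * (norm z powr \<alpha> * norm (p z)) \<partial>gauss)"
  proof (rule Bochner_Integration.integral_norm_bound_integral)
    show "integrable gauss (\<lambda>z. (h (pt t x z) - h (sqrt t *\<^sub>R x)) *\<^sub>R p z)"
      unfolding scaleR_diff_left using 1 2 by simp
    show "norm ((h (pt t x z) - h (sqrt t *\<^sub>R x)) *\<^sub>R p z) \<le> ?c * (norm z powr \<alpha> * norm (p z))" for z
      using mult_right_mono[OF holder_pt[OF t, of x z] norm_ge_zero[of "p z"]] by (simp add: mult.assoc)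
  qed (use 3 in auto)
  finally show ?thesis using 3 by simp
qed

text \<open>The bound is uniform in x, so it serves both for integrability and as the Lipschitz
  constant when differentiating under the time integral.\<close>

lemma norm_grad_kernel_le:
  obtains K where "K \<ge> 0" "\<And>t x. 0 < t \<Longrightarrow> t < 1 \<Longrightarrow>
    norm (grad_kernel t x) \<le> K * (t powr (-1/2) + (1 - t) powr (-1/2))"
proof
  let ?M = "\<integral>z. norm z powr \<alpha> * norm z \<partial>(gauss :: 'a measure)"
  have M: "?M \<ge> 0" by (intro integral_nonneg_AE) auto
  show "L * ?M \<ge> 0" using M L_nonneg by simp
  fix t :: real and x :: 'a assume t: "0 < t" "t < 1"
  define s r where "s = sqrt t" and "r = sqrt (1 - t)"
  have sr: "0 < s" "s \<le> 1" "0 < r" "r \<le> 1" "s * s + r * r = 1" using t by (auto simp: s_def r_def)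
  \<comment> \<open>Partial fractions from s^2 + r^2 = 1 separate the two end point singularities,
    each an integrable inverse square root.\<close>
  have "1 / (s * r) = (s * s + r * r) / (s * r)" using sr by simp
  also have "\<dots> = s / r + r / s" using sr(1,3) by (simp add: field_simps)
  also have "\<dots> \<le> 1 / r + 1 / s" using sr by (intro add_mono divide_right_mono) auto
  finally have *: "1 / (s * r) \<le> t powr (-1/2) + (1 - t) powr (-1/2)"
    using powr_half_sqrt[of t] powr_half_sqrt[of "1 - t"] t
    by (simp add: s_def r_def powr_minus_divide)
  have "norm (grad_kernel t x) = 1 / (2 * s * r) * norm (\<integral>z. h (pt t x z) *\<^sub>R z \<partial>gauss)"
    using sr by (simp add: grad_kernel_def s_def r_def)
  also have "\<dots> \<le> 1 / (2 * s * r) * (L * (1 - t) powr (\<alpha> / 2) * ?M)"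
    using sr t by (intro mult_left_mono centered_kernel_le) (auto simp: integral_gauss_id)
  also have "\<dots> \<le> 1 / (s * r) * (L * 1 * ?M)"
    using sr t M L_nonneg alpha powr_le1[of "\<alpha> / 2" "1 - t"]
    by (intro mult_mono mult_left_mono divide_left_mono) (auto simp: mult_left_le)
  also have "\<dots> \<le> (t powr (-1/2) + (1 - t) powr (-1/2)) * (L * ?M)"
    using mult_right_mono[OF *, of "L * ?M"] M L_nonneg by simp
  finally show "norm (grad_kernel t x) \<le> L * ?M * (t powr (-1/2) + (1 - t) powr (-1/2))"
    by (simp add: mult.commute)
qed

text \<open>A qualitative bound with \<open>K\<close> depending on the direction; \<alpha> > 0 puts
  the exponent above -1. The constant that matters for the theorem is found for quadratic forms
  only.\<close>

lemma norm_hess_kernel_le: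
  obtains K where "K \<ge> 0" "\<And>t x. 0 < t \<Longrightarrow> t < 1 \<Longrightarrow> norm (hess_kernel t x a) \<le> K * (1 - t) powr (\<alpha> / 2 - 1)"
proof
  let ?p = "\<lambda>z. (a \<bullet> z) *\<^sub>R z - a"
  let ?M = "\<integral>z. norm z powr \<alpha> * norm (?p z) \<partial>(gauss :: 'a measure)"
  have M: "?M \<ge> 0" by (intro integral_nonneg_AE) auto
  show "L / 2 * ?M \<ge> 0" using M L_nonneg by simp
  have p: "poly_growth (\<lambda>z. norm (?p z))"
  proof (rule poly_growth_mono[where g = "\<lambda>z. \<bar>a \<bullet> z\<bar> * norm z + norm a"])
    show "\<bar>norm (?p z)\<bar> \<le> \<bar>a \<bullet> z\<bar> * norm z + norm a" for z
      using norm_triangle_ineq4[of "(a \<bullet> z) *\<^sub>R z" a] by simp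
  qed (auto intro!: poly_growth_add poly_growth_mult poly_growth_abs)
  fix t :: real and x :: 'a assume t: "0 < t" "t < 1"
  have "norm (hess_kernel t x a) = 1 / (2 * (1 - t)) * norm (\<integral>z. h (pt t x z) *\<^sub>R ?p z \<partial>gauss)"
    using t by (simp add: hess_kernel_def)
  also have "\<dots> \<le> 1 / (2 * (1 - t)) * (L * (1 - t) powr (\<alpha> / 2) * ?M)"
    using t p by (intro mult_left_mono centered_kernel_le) (auto simp: integral_gauss_hermite)
  also have "\<dots> = L / 2 * ?M * (1 - t) powr (\<alpha> / 2 - 1)"
    using t by (simp add: powr_diff)
  finally show "norm (hess_kernel t x a) \<le> L / 2 * ?M * (1 - t) powr (\<alpha> / 2 - 1)" .
qed

lemma kernel_measurable [measurable]:
  "(\<lambda>t. interp t x) \<in> borel_measurable borel"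
  "(\<lambda>t. grad_kernel t x) \<in> borel_measurable borel"
  "(\<lambda>t. hess_kernel t x a) \<in> borel_measurable borel"
  unfolding interp_def grad_kernel_def hess_kernel_def by measurable

lemma unit_measurable: "f \<in> borel_measurable borel \<Longrightarrow> f \<in> borel_measurable unit_lborel"
  by (rule measurable_restrict_space1) simp

lemma integrable_grad_kernel: "integrable unit_lborel (\<lambda>t. grad_kernel t x)"
proof -
  obtain K where K: "K \<ge> 0" "\<And>t x. 0 < t \<Longrightarrow> t < 1 \<Longrightarrow>
    norm (grad_kernel t x) \<le> K * (t powr (-1/2) + (1 - t) powr (-1/2))"
    using norm_grad_kernel_le by blast
  show ?thesis
  proof (rule Bochner_Integration.integrable_bound)
    show "integrable unit_lborel (\<lambda>t. K * (t powr (-1/2) + (1 - t) powr (-1/2)))"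
      by (intro integrable_mult_right Bochner_Integration.integrable_add integrable_unit_powr) auto
    show "AE t in unit_lborel. norm (grad_kernel t x) \<le> norm (K * (t powr (-1/2) + (1 - t) powr (-1/2)))"
      using K by (intro AE_I2) (auto simp: space_restrict_space intro: order_trans[OF _ abs_ge_self])
  qed (auto intro!: unit_measurable)
qed

lemma integrable_hess_kernel: "integrable unit_lborel (\<lambda>t. hess_kernel t x a)"
proof -
  obtain K where K: "K \<ge> 0" "\<And>t x. 0 < t \<Longrightarrow> t < 1 \<Longrightarrow> norm (hess_kernel t x a) \<le> K * (1 - t) powr (\<alpha> / 2 - 1)"
    using norm_hess_kernel_le by blast
  show ?thesis
  proof (rule Bochner_Integration.integrable_bound)
    show "integrable unit_lborel (\<lambda>t. K * (1 - t) powr (\<alpha> / 2 - 1))"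
      using alpha by (intro integrable_mult_right integrable_unit_powr) auto
    show "AE t in unit_lborel. norm (hess_kernel t x a) \<le> norm (K * (1 - t) powr (\<alpha> / 2 - 1))"
      using K by (intro AE_I2) (auto simp: space_restrict_space intro: order_trans[OF _ abs_ge_self])
  qed (auto intro!: unit_measurable)
qed

end

lemma lipschitz_of_inner_derivative:
  fixes f :: "'a::euclidean_space \<Rightarrow> real"
  assumes "\<And>x. (f has_derivative (\<lambda>w. G x \<bullet> w)) (at x)" "\<And>x. norm (G x) \<le> B"
  shows "\<bar>f x - f y\<bar> \<le> B * norm (x - y)"
proof -
  have "norm (f x - f y) \<le> B * norm (x - y)"
  proof (rule differentiable_bound[of UNIV])
    fix z :: 'a
    show "onorm (\<lambda>w. G z \<bullet> w) \<le> B"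
    proof (rule onorm_le)
      show "norm (G z \<bullet> w) \<le> B * norm w" for w
        using Cauchy_Schwarz_ineq2[of "G z" w] mult_right_mono[OF assms(2)[of z] norm_ge_zero[of w]] by simp
    qed
  qed (use assms(1) in auto)
  then show ?thesis by simp
qed

text \<open>Passes to the gauge integral on the closed interval, where the fundamental theorem of
  calculus tolerates integrands unbounded at the ends.\<close>

lemma unit_lborel_has_integral:
  fixes f :: "real \<Rightarrow> real"
  assumes "integrable unit_lborel f"
  shows "(f has_integral (\<integral>t. f t \<partial>unit_lborel)) {0..1}"
proof -
  have "set_integrable lborel {0<..<1} f"
    using assms by (simp add: set_integrable_def integrable_restrict_space)
  from set_borel_integral_eq_integral[OF this]
  have "(f has_integral (LINT t:{0<..<1}|lborel. f t)) {0<..<1}"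
    by (simp add: has_integral_integrable_integral)
  then show ?thesis
    by (simp add: has_integral_Icc_iff_Ioo integral_restrict_space set_lebesgue_integral_def)
qed

text \<open>Polarisation: for a symmetric map the value T v . w is a difference of two quadratic
  forms, so the form controls the norm with no loss in the constant.\<close>

lemma norm_symmetric_linear_le:
  fixes T :: "'a::real_inner \<Rightarrow> 'a"
  assumes T: "linear T" and sym: "\<And>v w. T v \<bullet> w = T w \<bullet> v"
    and K: "\<And>v. \<bar>T v \<bullet> v\<bar> \<le> K * (norm v)\<^sup>2"
  shows "norm (T v) \<le> K * norm v"
proof (cases "T v = 0 \<or> v = 0")
  case True
  have "K * (norm v)\<^sup>2 \<ge> 0" using K[of v] by linarith
  then have "v \<noteq> 0 \<Longrightarrow> K \<ge> 0" by (simp add: zero_le_mult_iff)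
  with True show ?thesis using linear_0[OF T] by (cases "v = 0") auto
next
  case False
  \<comment> \<open>The direction of T v extracts its norm; the length |v| makes the parallelogram
    law return 4 |v|^2.\<close>
  define w where "w = (norm v / norm (T v)) *\<^sub>R T v"
  have w: "norm w = norm v" "T v \<bullet> w = norm v * norm (T v)"
    using False by (auto simp: w_def dot_square_norm power2_eq_square)
  have "4 * (T v \<bullet> w) = T (v + w) \<bullet> (v + w) - T (v - w) \<bullet> (v - w)"
    by (simp add: linear_add[OF T] linear_diff[OF T] inner_add inner_diff sym[of w v])
  also have "\<dots> \<le> K * (norm (v + w))\<^sup>2 + K * (norm (v - w))\<^sup>2"
    using K[of "v + w"] K[of "v - w"] by linarith
  also have "\<dots> = 2 * K * ((norm v)\<^sup>2 + (norm w)\<^sup>2)"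
    unfolding power2_norm_eq_inner by (simp add: inner_add inner_diff inner_commute algebra_simps del: dot_square_norm)
  finally have "norm v * norm (T v) \<le> norm v * (K * norm v)"
    by (simp add: w power2_eq_square algebra_simps)
  then show ?thesis using False by simp
qed

context holder_function
begin

definition sol :: "'a \<Rightarrow> real" where
  "sol x = - (\<integral>t. (interp t x - (\<integral>z. h z \<partial>gauss)) / (2 * t) \<partial>unit_lborel)"

definition sol_grad :: "'a \<Rightarrow> 'a" where
  "sol_grad x = - (\<integral>t. grad_kernel t x \<partial>unit_lborel)"

text \<open>The Hessian as a linear map applied to a direction, which allows a coordinate-free use
  of symmetry.\<close>

definition sol_hess :: "'a \<Rightarrow> 'a \<Rightarrow> 'a" where
  "sol_hess x a = - (\<integral>t. hess_kernel t x a \<partial>unit_lborel)"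

lemma poly_growth_h_id [simp]: "poly_growth h"
  using poly_growth_h[of 0 1] by simp

text \<open>Compensates the factor 1 / (2 t) at t = 0: the point \<open>pt t x z\<close> is within
  sqrt t (|x| + |z|) of z. The constant may depend on x, since it is used only for integrability at
  fixed x.\<close>

lemma abs_interp_minus_mean_le:
  obtains K where "\<And>t. 0 < t \<Longrightarrow> t < 1 \<Longrightarrow> \<bar>interp t x - (\<integral>z. h z \<partial>gauss)\<bar> \<le> K * t powr (\<alpha> / 2)"
proof
  fix t :: real assume t: "0 < t" "t < 1"
  have m: "poly_growth (\<lambda>z::'a. L * (1 + (norm x + norm z)))"
    by (intro poly_growth_mult poly_growth_add) auto
  have "interp t x - (\<integral>z. h z \<partial>gauss) = (\<integral>z. h (pt t x z) - h z \<partial>gauss)"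
    unfolding interp_def by (simp add: poly_growth_integrable)
  also have "norm \<dots> \<le> (\<integral>z. t powr (\<alpha> / 2) * (L * (1 + (norm x + norm z))) \<partial>(gauss :: 'a measure))"
  proof (rule Bochner_Integration.integral_norm_bound_integral)
    fix z :: 'a
    \<comment> \<open>From u <= sqrt u on [0, 1], used for u = 1 - t and for u = t: 1 - sqrt (1 - t)
      <= t <= sqrt t.\<close>
    have s: "1 - sqrt (1 - t) \<le> sqrt t" "1 - sqrt (1 - t) \<ge> 0"
    proof -
      have "1 - t \<le> sqrt (1 - t)" using t by (intro real_le_rsqrt) (simp add: power2_eq_square mult_left_le)
      moreover have "t \<le> sqrt t" using t by (intro real_le_rsqrt) (simp add: power2_eq_square mult_left_le)
      ultimately show "1 - sqrt (1 - t) \<le> sqrt t" by linarith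
    qed (use t in auto)
    have eq: "pt t x z - z = sqrt t *\<^sub>R x - (1 - sqrt (1 - t)) *\<^sub>R z"
      by (simp add: algebra_simps)
    have "norm (pt t x z - z) \<le> sqrt t * norm x + (1 - sqrt (1 - t)) * norm z"
      unfolding eq using norm_triangle_ineq4[of "sqrt t *\<^sub>R x" "(1 - sqrt (1 - t)) *\<^sub>R z"] s t by simp
    also have "\<dots> \<le> sqrt t * (norm x + norm z)"
      using mult_right_mono[OF s(1) norm_ge_zero[of z]] by (simp add: distrib_left)
    finally have "norm (pt t x z - z) powr \<alpha> \<le> (sqrt t * (norm x + norm z)) powr \<alpha>"
      using alpha by (intro powr_mono2) auto
    also have "\<dots> = t powr (\<alpha> / 2) * (norm x + norm z) powr \<alpha>"
      using t by (simp add: powr_mult powr_powr flip: powr_half_sqrt)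
    also have "\<dots> \<le> t powr (\<alpha> / 2) * (1 + (norm x + norm z))"
      using alpha by (intro mult_left_mono powr_le_1_plus) auto
    finally have "L * norm (pt t x z - z) powr \<alpha> \<le> L * (t powr (\<alpha> / 2) * (1 + (norm x + norm z)))"
      using L_nonneg by (rule mult_left_mono)
    with holder[of "pt t x z" z]
    show "norm (h (pt t x z) - h z) \<le> t powr (\<alpha> / 2) * (L * (1 + (norm x + norm z)))"
      by (simp add: mult.left_commute)
  qed (auto intro!: poly_growth_integrable poly_growth_diff poly_growth_mult poly_growth_add)
  finally show "\<bar>interp t x - (\<integral>z. h z \<partial>gauss)\<bar> \<le> (\<integral>z. L * (1 + (norm x + norm z)) \<partial>(gauss :: 'a measure)) * t powr (\<alpha> / 2)"
    by (simp add: mult.commute)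
qed

lemma sol_integrable: "integrable unit_lborel (\<lambda>t. (interp t x - (\<integral>z. h z \<partial>gauss)) / (2 * t))"
proof -
  obtain K where K: "\<And>t. 0 < t \<Longrightarrow> t < 1 \<Longrightarrow> \<bar>interp t x - (\<integral>z. h z \<partial>gauss)\<bar> \<le> K * t powr (\<alpha> / 2)"
    using abs_interp_minus_mean_le by blast
  show ?thesis
  proof (rule Bochner_Integration.integrable_bound)
    show "integrable unit_lborel (\<lambda>t. K / 2 * t powr (\<alpha> / 2 - 1))"
      using alpha by (intro integrable_mult_right integrable_unit_powr) auto
    show "AE t in unit_lborel. norm ((interp t x - (\<integral>z. h z \<partial>gauss)) / (2 * t)) \<le> norm (K / 2 * t powr (\<alpha> / 2 - 1))"
    proof (rule AE_I2)
      fix t :: real assume "t \<in> space unit_lborel"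
      then have t: "0 < t" "t < 1" by (auto simp: space_restrict_space)
      have "norm ((interp t x - (\<integral>z. h z \<partial>gauss)) / (2 * t)) \<le> K * t powr (\<alpha> / 2) / (2 * t)"
        using K[OF t] t by (simp add: divide_right_mono)
      also have "\<dots> = K / 2 * t powr (\<alpha> / 2 - 1)" using t by (simp add: powr_diff)
      finally show "norm ((interp t x - (\<integral>z. h z \<partial>gauss)) / (2 * t)) \<le> norm (K / 2 * t powr (\<alpha> / 2 - 1))"
        by simp
    qed
  qed (auto intro!: unit_measurable)
qed

lemma sol_has_derivative: "(sol has_derivative (\<lambda>w. sol_grad x \<bullet> w)) (at x)"
proof -
  let ?m = "\<integral>z. h z \<partial>gauss"
  obtain K where K: "K \<ge> 0" "\<And>t x. 0 < t \<Longrightarrow> t < 1 \<Longrightarrow>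
    norm (grad_kernel t x) \<le> K * (t powr (-1/2) + (1 - t) powr (-1/2))"
    using norm_grad_kernel_le by blast
  have d: "((\<lambda>p. (interp t p - ?m) / (2 * t)) has_derivative (\<lambda>w. grad_kernel t y \<bullet> w)) (at y)"
    if "0 < t" "t < 1" for t y
    using has_derivative_diff[OF interp_has_derivative[OF that] has_derivative_const[of "?m / (2 * t)"]]
    by (simp add: diff_divide_distrib)
  have "((\<lambda>p. \<integral>t. (interp t p - ?m) / (2 * t) \<partial>unit_lborel) has_derivative
      (\<lambda>w. (\<integral>t. grad_kernel t x \<partial>unit_lborel) \<bullet> w)) (at x)"
  \<comment> \<open>The radius is arbitrary because the kernel bound holds for all x.\<close>
  proof (rule has_derivative_lebesgue_integral[where r = 1 and
      B = "\<lambda>t. K * (t powr (-1/2) + (1 - t) powr (-1/2))"])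
    show "integrable unit_lborel (\<lambda>t. K * (t powr (-1/2) + (1 - t) powr (-1/2)))"
      by (intro integrable_mult_right Bochner_Integration.integrable_add integrable_unit_powr) auto
    fix t :: real assume "t \<in> space unit_lborel"
    then have t: "0 < t" "t < 1" by (auto simp: space_restrict_space)
    show "((\<lambda>p. (interp t p - ?m) / (2 * t)) has_derivative (\<lambda>w. grad_kernel t x \<bullet> w)) (at x)"
      by (rule d[OF t])
    show "\<bar>(interp t p - ?m) / (2 * t) - (interp t x - ?m) / (2 * t)\<bar>
        \<le> K * (t powr (-1/2) + (1 - t) powr (-1/2)) * norm (p - x)" for p
      by (rule lipschitz_of_inner_derivative[OF d[OF t] K(2)[OF t]])
  qed (auto intro: sol_integrable integrable_grad_kernel)
  from has_derivative_minus[OF this] show ?thesis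
    by (simp add: sol_def[abs_def] sol_grad_def)
qed

lemma sol_grad_inner: "sol_grad x \<bullet> a = - (\<integral>t. grad_kernel t x \<bullet> a \<partial>unit_lborel)"
  by (simp add: sol_grad_def integrable_grad_kernel)

lemma sol_hess_inner: "sol_hess x a \<bullet> b = - (\<integral>t. hess_kernel t x a \<bullet> b \<partial>unit_lborel)"
  by (simp add: sol_hess_def integrable_hess_kernel)

lemma sol_grad_has_derivative: "((\<lambda>x. sol_grad x \<bullet> a) has_derivative (\<lambda>w. sol_hess x a \<bullet> w)) (at x)"
proof -
  obtain K where K: "K \<ge> 0" "\<And>t x. 0 < t \<Longrightarrow> t < 1 \<Longrightarrow> norm (hess_kernel t x a) \<le> K * (1 - t) powr (\<alpha> / 2 - 1)"
    using norm_hess_kernel_le by blast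
  have "((\<lambda>p. \<integral>t. grad_kernel t p \<bullet> a \<partial>unit_lborel) has_derivative
      (\<lambda>w. (\<integral>t. hess_kernel t x a \<partial>unit_lborel) \<bullet> w)) (at x)"
  proof (rule has_derivative_lebesgue_integral[where r = 1 and B = "\<lambda>t. K * (1 - t) powr (\<alpha> / 2 - 1)"])
    show "integrable unit_lborel (\<lambda>t. K * (1 - t) powr (\<alpha> / 2 - 1))"
      using alpha by (intro integrable_mult_right integrable_unit_powr) auto
    fix t :: real assume "t \<in> space unit_lborel"
    then have t: "0 < t" "t < 1" by (auto simp: space_restrict_space)
    show "((\<lambda>p. grad_kernel t p \<bullet> a) has_derivative (\<lambda>w. hess_kernel t x a \<bullet> w)) (at x)"
      by (rule grad_kernel_has_derivative[OF t])
    show "\<bar>grad_kernel t p \<bullet> a - grad_kernel t x \<bullet> a\<bar> \<le> K * (1 - t) powr (\<alpha> / 2 - 1) * norm (p - x)" for p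
      by (rule lipschitz_of_inner_derivative[OF grad_kernel_has_derivative[OF t] K(2)[OF t]])
  qed (auto intro!: integrable_inner_left integrable_hess_kernel integrable_grad_kernel)
  from has_derivative_minus[OF this] show ?thesis
    unfolding sol_grad_inner[abs_def] by (simp add: sol_hess_def)
qed

text \<open>The time derivative is known only inside (0, 1) and may blow up at the ends; continuity
  up to both ends is what lets the fundamental theorem of calculus reach them.\<close>

lemma continuous_on_interp: "continuous_on {0..1} (\<lambda>t. interp t x)"
proof (subst continuous_on_sequentially, intro allI ballI impI, elim conjE)
  fix T :: "nat \<Rightarrow> real" and t assume T: "\<forall>n. T n \<in> {0..1}" "T \<longlonglongrightarrow> t" and t: "t \<in> {0..1}"
  have "(\<lambda>n. interp (T n) x) \<longlonglongrightarrow> interp t x"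
    unfolding interp_def
  proof (rule integral_dominated_convergence[where w = "\<lambda>z. \<bar>h 0\<bar> + L * (1 + (norm x + norm z))"])
    show "integrable gauss (\<lambda>z::'a. \<bar>h 0\<bar> + L * (1 + (norm x + norm z)))"
      by (intro poly_growth_integrable poly_growth_add poly_growth_mult) auto
    show "AE z in gauss. (\<lambda>n. h (pt (T n) x z)) \<longlonglongrightarrow> h (pt t x z)"
    proof (rule AE_I2)
      fix z :: 'a
      have "(\<lambda>n. pt (T n) x z) \<longlonglongrightarrow> pt t x z" by (intro tendsto_intros T)
      then show "(\<lambda>n. h (pt (T n) x z)) \<longlonglongrightarrow> h (pt t x z)"
        using continuous_on_tendsto_compose[OF continuous_h[of UNIV]] by simp
    qed
    show "AE z in gauss. norm (h (pt (T n) x z)) \<le> \<bar>h 0\<bar> + L * (1 + (norm x + norm z))" for n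
    proof (rule AE_I2)
      fix z :: 'a
      have Tn: "0 \<le> T n" "T n \<le> 1" using T by auto
      have "norm (pt (T n) x z) \<le> sqrt (T n) * norm x + sqrt (1 - T n) * norm z"
        using norm_triangle_ineq[of "sqrt (T n) *\<^sub>R x" "sqrt (1 - T n) *\<^sub>R z"] Tn by simp
      also have "\<dots> \<le> norm x + norm z" using Tn by (intro add_mono mult_left_le_one_le) auto
      finally have "L * (1 + norm (pt (T n) x z)) \<le> L * (1 + (norm x + norm z))"
        using L_nonneg by (intro mult_left_mono) auto
      then show "norm (h (pt (T n) x z)) \<le> \<bar>h 0\<bar> + L * (1 + (norm x + norm z))"
        using abs_h_le[of 0 "pt (T n) x z"] by simp
    qed
  qed auto
  then show "((\<lambda>t. interp t x) \<circ> T) \<longlonglongrightarrow> interp t x" by (simp add: o_def)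
qed

lemma stein_equation:
  "(\<Sum>b\<in>Basis. sol_hess x b \<bullet> b) - sol_grad x \<bullet> x = h x - (\<integral>z. h z \<partial>gauss)"
proof -
  let ?D = "\<lambda>t. grad_kernel t x \<bullet> x - (\<Sum>b\<in>Basis. hess_kernel t x b \<bullet> b)"
  have i: "integrable unit_lborel (\<lambda>t. grad_kernel t x \<bullet> x)"
    "integrable unit_lborel (\<lambda>t. \<Sum>b\<in>Basis. hess_kernel t x b \<bullet> b)"
    by (auto intro!: integrable_inner_left integrable_grad_kernel integrable_hess_kernel)
  \<comment> \<open>The gauge integral is obtained from the end point values alone; uniqueness then
    identifies it with the Lebesgue integrals that define \<open>sol_grad\<close> and
    \<open>sol_hess\<close>.\<close>
  have 1: "(?D has_integral (interp 1 x - interp 0 x)) {0..1}"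
    by (rule fundamental_theorem_of_calculus_interior)
       (auto intro: continuous_on_interp interp_has_time_derivative[unfolded has_real_derivative_iff_has_vector_derivative])
  have 2: "(?D has_integral (\<integral>t. ?D t \<partial>unit_lborel)) {0..1}"
    by (intro unit_lborel_has_integral Bochner_Integration.integrable_diff i)
  have "(\<integral>t. ?D t \<partial>unit_lborel) = interp 1 x - interp 0 x"
    by (rule has_integral_unique[OF 2 1])
  also have "(\<integral>t. ?D t \<partial>unit_lborel) = (\<Sum>b\<in>Basis. sol_hess x b \<bullet> b) - sol_grad x \<bullet> x"
    unfolding Bochner_Integration.integral_diff[OF i]
    by (subst Bochner_Integration.integral_sum)
       (auto simp: sol_hess_inner sol_grad_inner sum_negf intro!: integrable_inner_left integrable_hess_kernel)
  also have "interp 1 x - interp 0 x = h x - (\<integral>z. h z \<partial>gauss)"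
    by (simp add: interp_def)
  finally show ?thesis .
qed

lemma sol_hess_symmetric: "sol_hess x a \<bullet> b = sol_hess x b \<bullet> a"
  unfolding sol_hess_inner hess_kernel_inner by (simp add: mult.commute inner_commute)

text \<open>Linearity is evident in the second slot of the bilinear form, and symmetry carries it to
  the first.\<close>

lemma linear_sol_hess: "linear (sol_hess x)"
proof (rule linearI)
  fix a b :: 'a and c :: real
  show "sol_hess x (a + b) = sol_hess x a + sol_hess x b"
  proof (rule euclidean_eqI)
    fix e :: 'a
    show "sol_hess x (a + b) \<bullet> e = (sol_hess x a + sol_hess x b) \<bullet> e"
      using sol_hess_symmetric[of x "a + b" e] sol_hess_symmetric[of x a e] sol_hess_symmetric[of x b e]
      by (simp add: inner_add_left inner_add_right)
  qed
  show "sol_hess x (c *\<^sub>R a) = c *\<^sub>R sol_hess x a"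
  proof (rule euclidean_eqI)
    fix e :: 'a
    show "sol_hess x (c *\<^sub>R a) \<bullet> e = (c *\<^sub>R sol_hess x a) \<bullet> e"
      using sol_hess_symmetric[of x "c *\<^sub>R a" e] sol_hess_symmetric[of x a e] by simp
  qed
qed

text \<open>Both points are compared under the same z, so the noise cancels and the increment of
  \<open>h\<close> does not depend on it; the weight enters through its first absolute moment alone.
  At t = 1 both sides are 0 by division by zero.\<close>

lemma hess_kernel_diff_le:
  assumes t: "0 \<le> t" "t \<le> 1" and u: "norm u = 1"
  shows "\<bar>hess_kernel t x u \<bullet> u - hess_kernel t y u \<bullet> u\<bar> \<le> L * norm (x - y) powr \<alpha> / (2 * (1 - t))"
proof -
  let ?w = "\<lambda>z. (u \<bullet> z)\<^sup>2 - 1"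
  have w: "poly_growth ?w" by (intro poly_growth_diff poly_growth_power) auto
  have uu: "u \<bullet> u = 1" using u by (simp add: dot_square_norm)
  have "hess_kernel t x u \<bullet> u - hess_kernel t y u \<bullet> u
      = (\<integral>z. (h (pt t x z) - h (pt t y z)) * ?w z \<partial>gauss) / (2 * (1 - t))"
    using w by (simp add: hess_kernel_inner uu diff_divide_distrib[symmetric] left_diff_distrib
      poly_growth_integrable poly_growth_mult flip: power2_eq_square)
  moreover have "norm (\<integral>z. (h (pt t x z) - h (pt t y z)) * ?w z \<partial>gauss) \<le> (\<integral>z. L * norm (x - y) powr \<alpha> * \<bar>?w z\<bar> \<partial>gauss)"
  proof (rule Bochner_Integration.integral_norm_bound_integral)
    fix z :: 'a
    have "\<bar>h (pt t x z) - h (pt t y z)\<bar> \<le> L * norm (pt t x z - pt t y z) powr \<alpha>" by (rule holder)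
    also have "pt t x z - pt t y z = sqrt t *\<^sub>R (x - y)" by (simp add: algebra_simps)
    also have "L * norm (sqrt t *\<^sub>R (x - y)) powr \<alpha> \<le> L * norm (x - y) powr \<alpha>"
      using t alpha L_nonneg by (intro mult_left_mono powr_mono2) (auto simp: mult_left_le_one_le)
    finally show "norm ((h (pt t x z) - h (pt t y z)) * ?w z) \<le> L * norm (x - y) powr \<alpha> * \<bar>?w z\<bar>"
      by (simp add: abs_mult mult_right_mono)
  qed (use w in \<open>auto intro!: poly_growth_integrable poly_growth_diff poly_growth_mult poly_growth_abs\<close>)
  moreover have "\<dots> \<le> L * norm (x - y) powr \<alpha> * 1"
    using mult_left_mono[OF integral_gauss_abs_inner_square[OF u], of "L * norm (x - y) powr \<alpha>"] L_nonneg
    by simp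
  ultimately show ?thesis
    using t by (simp add: divide_right_mono)
qed

text \<open>In a unit direction the weight is scalar and its moment is compared with
  \<open>C1\<close>. The factor \<alpha>/4 is set so that two such terms give \<alpha>/2, which
  integrates over [0, 1] to exactly \<open>C1\<close>.\<close>

lemma hess_kernel_le:
  assumes t: "0 \<le> t" "t \<le> 1" and u: "norm u = 1"
  shows "\<bar>hess_kernel t x u \<bullet> u\<bar> \<le> L * C1 \<alpha> DIM('a) * (\<alpha> / 4) * (1 - t) powr (\<alpha> / 2 - 1)"
proof (cases "t = 1")
  \<comment> \<open>Both sides vanish at t = 1: the kernel through 1 / 0 = 0, the bound through 0
    \<open>powr\<close> anything being 0.\<close>
  case True
  then show ?thesis by (simp add: hess_kernel_def)
next
  case False
  let ?w = "\<lambda>z. (u \<bullet> z)\<^sup>2 - 1"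
  let ?Q = "\<integral>z. norm z powr \<alpha> * \<bar>?w z\<bar> \<partial>(gauss :: 'a measure)"
  have w: "poly_growth ?w" by (intro poly_growth_diff poly_growth_power) auto
  have uu: "u \<bullet> u = 1" using u by (simp add: dot_square_norm)
  have "?Q \<le> 3 / 2 * DIM('a) powr (\<alpha> / 2)"
    using integral_gauss_weight_norm_powr[OF u alpha] by (simp add: mult.commute)
  also have "\<dots> \<le> \<alpha> / 2 * C1 \<alpha> DIM('a)"
    using alpha by (intro C1_ge) (auto simp: Suc_le_eq)
  finally have Q: "?Q \<le> \<alpha> / 2 * C1 \<alpha> DIM('a)" .
  have "(\<integral>z. ?w z \<partial>(gauss :: 'a measure)) = 0"
    using integral_gauss_inner_power(1)[OF u] by (simp add: poly_growth_integrable poly_growth_power)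
  then have "norm (\<integral>z. h (pt t x z) *\<^sub>R ?w z \<partial>gauss) \<le> L * (1 - t) powr (\<alpha> / 2) * (\<integral>z. norm z powr \<alpha> * norm (?w z) \<partial>gauss)"
    using w t by (intro centered_kernel_le) (auto intro: poly_growth_abs)
  also have "\<dots> \<le> L * (1 - t) powr (\<alpha> / 2) * (\<alpha> / 2 * C1 \<alpha> DIM('a))"
    using Q L_nonneg by (intro mult_left_mono) auto
  finally have le: "norm (\<integral>z. h (pt t x z) *\<^sub>R ?w z \<partial>gauss) \<le> L * (1 - t) powr (\<alpha> / 2) * (\<alpha> / 2 * C1 \<alpha> DIM('a))" .
  have "\<bar>hess_kernel t x u \<bullet> u\<bar> = norm (\<integral>z. h (pt t x z) *\<^sub>R ?w z \<partial>gauss) / (2 * (1 - t))"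
    using t by (simp add: hess_kernel_inner uu abs_divide flip: power2_eq_square)
  also have "\<dots> \<le> L * (1 - t) powr (\<alpha> / 2) * (\<alpha> / 2 * C1 \<alpha> DIM('a)) / (2 * (1 - t))"
    using t by (intro divide_right_mono le) auto
  also have "\<dots> = L * C1 \<alpha> DIM('a) * (\<alpha> / 4) * (1 - t) powr (\<alpha> / 2 - 1)"
    using t False by (simp add: powr_diff)
  finally show ?thesis .
qed

end

section \<open>Modulus of continuity of the Hessian\<close>

lemma C1_nonneg:
  assumes "0 < a" "a \<le> 1" "d \<ge> 1"
  shows "C1 a d \<ge> 0"
proof -
  have "0 \<le> a / 2 * C1 a d" using C1_ge[OF assms] by (rule order_trans[rotated]) simp
  with assms(1) show ?thesis by (simp add: zero_le_mult_iff)
qed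

lemma integral_log_head:
  fixes A e :: real
  assumes "0 < e" "e \<le> 1"
  shows "((\<lambda>t. A / (2 * (1 - t))) has_integral - (A * ln e / 2)) {0..1 - e}"
proof -
  have "((\<lambda>t. A / (2 * (1 - t))) has_integral
      (- (A / 2) * ln (1 - (1 - e))) - (- (A / 2) * ln (1 - 0))) {0..1 - e}"
  proof (rule fundamental_theorem_of_calculus_interior)
    show "continuous_on {0..1 - e} (\<lambda>t. - (A / 2) * ln (1 - t))"
      using assms by (intro continuous_intros) auto
    fix t assume "t \<in> {0<..<1 - e}"
    then show "((\<lambda>t. - (A / 2) * ln (1 - t)) has_vector_derivative A / (2 * (1 - t))) (at t)"
      using assms unfolding has_real_derivative_iff_has_vector_derivative[symmetric]
      by (auto intro!: derivative_eq_intros simp: field_simps)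
  qed (use assms in auto)
  then show ?thesis by simp
qed

context holder_function
begin

lemma C_nonneg: "C1 \<alpha> DIM('a) \<ge> 0"
  using alpha by (intro C1_nonneg) (auto simp: Suc_le_eq)

lemma integral_powr_tail:
  assumes "0 \<le> c" "c \<le> 1"
  shows "((\<lambda>t. A * (\<alpha> / 2) * (1 - t) powr (\<alpha> / 2 - 1)) has_integral A * (1 - c) powr (\<alpha> / 2)) {c..1}"
proof -
  have "((\<lambda>t. A * (\<alpha> / 2) * (1 - t) powr (\<alpha> / 2 - 1)) has_integral
      (- A * (1 - 1) powr (\<alpha> / 2)) - (- A * (1 - c) powr (\<alpha> / 2))) {c..1}"
  proof (rule fundamental_theorem_of_calculus_interior)
    show "continuous_on {c..1} (\<lambda>t. - A * (1 - t) powr (\<alpha> / 2))"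
      using alpha by (intro continuous_intros continuous_on_powr') auto
    fix t assume "t \<in> {c<..<1}"
    then show "((\<lambda>t. - A * (1 - t) powr (\<alpha> / 2)) has_vector_derivative
        A * (\<alpha> / 2) * (1 - t) powr (\<alpha> / 2 - 1)) (at t)"
      unfolding has_real_derivative_iff_has_vector_derivative[symmetric]
      by (auto intro!: derivative_eq_intros simp: powr_diff)
  qed (use assms in auto)
  then show ?thesis by simp
qed

text \<open>The derivative of the component along b is w -> \<open>sol_hess x b\<close> . w;
  symmetry moves w into the argument of the Hessian.\<close>

lemma sol_grad_has_derivative_vector: "(sol_grad has_derivative sol_hess x) (at x)"
  by (subst has_derivative_componentwise_within)
     (use sol_grad_has_derivative in \<open>simp add: sol_hess_symmetric[of x _ b for b]\<close>)

lemma sol_hess_diff_has_integral: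
  "((\<lambda>t. hess_kernel t x u \<bullet> u - hess_kernel t y u \<bullet> u) has_integral
    - ((sol_hess x u - sol_hess y u) \<bullet> u)) {0..1}"
proof -
  have "integrable unit_lborel (\<lambda>t. hess_kernel t x u \<bullet> u - hess_kernel t y u \<bullet> u)"
    by (intro Bochner_Integration.integrable_diff integrable_inner_left integrable_hess_kernel)
  from unit_lborel_has_integral[OF this] show ?thesis
    by (simp add: inner_diff_left sol_hess_inner integrable_hess_kernel)
qed

lemma hess_kernel_diff_le_tail:
  assumes "0 \<le> t" "t \<le> 1" "norm u = 1"
  shows "\<bar>hess_kernel t x u \<bullet> u - hess_kernel t y u \<bullet> u\<bar> \<le> L * C1 \<alpha> DIM('a) * (\<alpha> / 2) * (1 - t) powr (\<alpha> / 2 - 1)"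
  using hess_kernel_le[OF assms, of x] hess_kernel_le[OF assms, of y] by linarith

lemma sol_hess_form_le:
  assumes u: "norm u = 1"
  shows "\<bar>(sol_hess x u - sol_hess y u) \<bullet> u\<bar> \<le> L * C1 \<alpha> DIM('a)"
proof -
  let ?D = "\<lambda>t. hess_kernel t x u \<bullet> u - hess_kernel t y u \<bullet> u"
  let ?g = "\<lambda>t. L * C1 \<alpha> DIM('a) * (\<alpha> / 2) * (1 - t) powr (\<alpha> / 2 - 1)"
  have I: "(?g has_integral L * C1 \<alpha> DIM('a)) {0..1}"
    using integral_powr_tail[of 0 "L * C1 \<alpha> DIM('a)"] by simp
  have "norm (integral {0..1} ?D) \<le> integral {0..1} ?g"
    using hess_kernel_diff_le_tail[OF _ _ u, of _ x y] I sol_hess_diff_has_integral[of x u y]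
    by (intro Henstock_Kurzweil_Integration.integral_norm_bound_integral) auto
  also have "integral {0..1} ?g = L * C1 \<alpha> DIM('a)"
    by (rule integral_unique[OF I])
  finally show ?thesis
    unfolding integral_unique[OF sol_hess_diff_has_integral[of x u y]] by simp
qed

text \<open>The cut is at 1 - t = r^2 because there r^\<alpha> / (1 - t) and (1 - t)^(\<alpha>/2 -
  1) are both r^(\<alpha> - 2). The logarithm is the integral of 1 / (1 - t) up to the cut.\<close>

lemma sol_hess_form_le_log:
  assumes u: "norm u = 1" and xy: "x \<noteq> y" "norm (x - y) \<le> 1"
  shows "\<bar>(sol_hess x u - sol_hess y u) \<bullet> u\<bar> \<le> L * norm (x - y) powr \<alpha> * (C1 \<alpha> DIM('a) - ln (norm (x - y)))"
proof -
  define r where "r = norm (x - y)"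
  have r: "0 < r" "r \<le> 1" using xy by (auto simp: r_def)
  have e: "0 < r\<^sup>2" "r\<^sup>2 \<le> 1" using r by (auto simp: power_le_one)
  let ?D = "\<lambda>t. hess_kernel t x u \<bullet> u - hess_kernel t y u \<bullet> u"
  have D: "?D integrable_on {0..1}"
    using sol_hess_diff_has_integral by blast
  have D1: "?D integrable_on {0..1 - r\<^sup>2}" and D2: "?D integrable_on {1 - r\<^sup>2..1}"
    by (rule integrable_subinterval_real[OF D], use e in auto)+
  note I1 = integral_log_head[OF e, of "L * r powr \<alpha>"]
  have "0 \<le> 1 - r\<^sup>2" "1 - r\<^sup>2 \<le> 1" using e by auto
  note I2 = integral_powr_tail[OF this, of "L * C1 \<alpha> DIM('a)"]
  have 1: "\<bar>integral {0..1 - r\<^sup>2} ?D\<bar> \<le> integral {0..1 - r\<^sup>2} (\<lambda>t. L * r powr \<alpha> / (2 * (1 - t)))"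
  proof (rule Henstock_Kurzweil_Integration.integral_norm_bound_integral[where f = ?D, unfolded real_norm_def, OF D1])
    fix t assume "t \<in> {0..1 - r\<^sup>2}"
    then have "0 \<le> t" "t \<le> 1 - r\<^sup>2" by auto
    moreover from this have "t \<le> 1" using zero_le_power2[of r] by linarith
    ultimately show "\<bar>?D t\<bar> \<le> L * r powr \<alpha> / (2 * (1 - t))"
      unfolding r_def by (intro hess_kernel_diff_le u)
  qed (use I1 in blast)
  have 2: "\<bar>integral {1 - r\<^sup>2..1} ?D\<bar> \<le> integral {1 - r\<^sup>2..1} (\<lambda>t. L * C1 \<alpha> DIM('a) * (\<alpha> / 2) * (1 - t) powr (\<alpha> / 2 - 1))"
    using D2 I2 hess_kernel_diff_le_tail[OF _ _ u, of _ x y] e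
    by (intro Henstock_Kurzweil_Integration.integral_norm_bound_integral[where f = ?D, unfolded real_norm_def]) auto
  have 3: "integral {0..1 - r\<^sup>2} ?D + integral {1 - r\<^sup>2..1} ?D = - ((sol_hess x u - sol_hess y u) \<bullet> u)"
    using Henstock_Kurzweil_Integration.integral_combine[OF _ _ D, of "1 - r\<^sup>2"] e
      integral_unique[OF sol_hess_diff_has_integral[of x u y]] by simp
  have "\<bar>(sol_hess x u - sol_hess y u) \<bullet> u\<bar>
      \<le> - (L * r powr \<alpha> * ln (r\<^sup>2) / 2) + L * C1 \<alpha> DIM('a) * (1 - (1 - r\<^sup>2)) powr (\<alpha> / 2)"
    using 1 2 3 unfolding integral_unique[OF I1] integral_unique[OF I2] by linarith
  also have "1 - (1 - r\<^sup>2) = r\<^sup>2" by simp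
  \<comment> \<open>The square in the cut disappears twice: the tail becomes r^\<alpha>, and the
    factor 1/2 of the head absorbs ln (r^2) = 2 ln r.\<close>
  also have "(r\<^sup>2) powr (\<alpha> / 2) = r powr \<alpha>"
    using r by (simp add: powr_powr flip: powr_numeral)
  also have "ln (r\<^sup>2) = 2 * ln r" using r by (simp add: ln_realpow)
  finally show ?thesis by (simp add: r_def algebra_simps)
qed

lemma norm_sol_hess_diff_le:
  assumes "\<And>u. norm u = 1 \<Longrightarrow> \<bar>(sol_hess x u - sol_hess y u) \<bullet> u\<bar> \<le> K"
  shows "norm (sol_hess x v - sol_hess y v) \<le> K * norm v"
proof (rule norm_symmetric_linear_le)
  show lin: "linear (\<lambda>v. sol_hess x v - sol_hess y v)"
    by (intro linear_compose_sub linear_sol_hess)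
  show "(sol_hess x v - sol_hess y v) \<bullet> w = (sol_hess x w - sol_hess y w) \<bullet> v" for v w
    by (simp add: inner_diff_left sol_hess_symmetric[of _ v w])
  show "\<bar>(sol_hess x v - sol_hess y v) \<bullet> v\<bar> \<le> K * (norm v)\<^sup>2" for v
  proof (cases "v = 0")
    case False
    define u where "u = v /\<^sub>R norm v"
    have v: "v = norm v *\<^sub>R u" and u: "norm u = 1" using False by (auto simp: u_def)
    have "sol_hess x v - sol_hess y v = norm v *\<^sub>R (sol_hess x u - sol_hess y u)"
      using linear_scale[OF lin, of "norm v" u] v by simp
    then have "(sol_hess x v - sol_hess y v) \<bullet> v = (norm v)\<^sup>2 * ((sol_hess x u - sol_hess y u) \<bullet> u)"
      by (subst (3) v) (simp add: power2_eq_square)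
    then show ?thesis
      using mult_left_mono[OF assms[OF u], of "(norm v)\<^sup>2"] by (simp add: abs_mult mult.commute)
  qed simp
qed

end

text \<open>The inequality ln y <= y - 1 at y = r^(-g), multiplied by r^g. It trades the logarithm
  for a loss g in the Hoelder exponent.\<close>

lemma log_le_powr:
  fixes g r :: real
  assumes "0 < g" "0 < r" "r \<le> 1"
  shows "- ln r * r powr g \<le> 1 / g"
proof -
  have "- ln (r powr g) \<le> 1 / r powr g - 1"
    using ln_le_minus_one[of "1 / r powr g"] assms by (simp add: ln_div)
  then have "- ln (r powr g) * r powr g \<le> (1 / r powr g - 1) * r powr g"
    by (rule mult_right_mono) simp
  also have "\<dots> = 1 - r powr g" using assms by (simp add: left_diff_distrib)
  also have "\<dots> \<le> 1" by simp
  finally have "- ln (r powr g) * r powr g \<le> 1" .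
  then show ?thesis using assms by (simp add: ln_powr field_simps)
qed

section \<open>Transfer to coordinates and to the given Gaussian vector\<close>

lemma Basis_vec_real: "(Basis :: (real ^ 'n) set) = range (\<lambda>i. axis i 1)"
  by (auto simp: Basis_vec_def)

lemma inj_axis_1: "inj (\<lambda>i. axis i (1 :: real))"
  by (auto simp: inj_on_def axis_eq_axis)

lemma std_gaussian_vector_distr:
  fixes Z :: "'w \<Rightarrow> real ^ 'n"
  assumes "std_gaussian_vector M Z"
  shows "distr M borel Z = gauss" "Z \<in> borel_measurable M"
proof -
  have d: "distributed M lborel Z (\<lambda>z. ennreal (\<Prod>i\<in>UNIV. std_normal_density (z $ i)))"
    using assms by (simp add: std_gaussian_vector_def)
  have "(\<Prod>i\<in>UNIV. std_normal_density (z $ i)) = gauss_density z" for z :: "real ^ 'n"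
  proof -
    have "(\<Prod>b\<in>Basis. std_normal_density (z \<bullet> b)) = (\<Prod>i\<in>UNIV. std_normal_density (z $ i))"
      unfolding Basis_vec_real by (simp add: prod.reindex inj_axis_1 inner_axis)
    then show ?thesis by (simp add: gauss_density_prod)
  qed
  then show "distr M borel Z = gauss"
    using distributed_distr_eq_density[OF d] unfolding gauss_def
    by (simp cong: distr_cong)
  show "Z \<in> borel_measurable M"
    using distributed_measurable[OF d] by simp
qed

lemma holder_seminorm_bound:
  fixes h :: "real ^ 'n \<Rightarrow> real"
  assumes "holder_seminorm \<alpha> h < \<infinity>"
  shows "\<bar>h x - h y\<bar> \<le> enn2real (holder_seminorm \<alpha> h) * norm (x - y) powr \<alpha>"
proof (cases "x = y")
  case False
  have "ennreal (\<bar>h x - h y\<bar> / norm (x - y) powr \<alpha>) \<le> holder_seminorm \<alpha> h"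
    unfolding holder_seminorm_def by (rule SUP_upper2[of "(x, y)"]) (use False in auto)
  also have "\<dots> = ennreal (enn2real (holder_seminorm \<alpha> h))"
    using assms by (simp add: less_top)
  finally have "\<bar>h x - h y\<bar> / norm (x - y) powr \<alpha> \<le> enn2real (holder_seminorm \<alpha> h)"
    by (simp add: ennreal_le_iff)
  then show ?thesis using False by (simp add: divide_le_eq)
qed simp

lemma holder_seminorm_finiteI:
  assumes "\<And>x y. x \<noteq> y \<Longrightarrow> \<bar>h x - h y\<bar> \<le> K * norm (x - y) powr \<beta>"
  shows "holder_seminorm \<beta> h < \<infinity>"
proof -
  have "holder_seminorm \<beta> h \<le> ennreal K"
    unfolding holder_seminorm_def
    by (rule SUP_least) (use assms in \<open>auto intro!: ennreal_leI simp: divide_le_eq\<close>)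
  then show ?thesis by (simp add: le_less_trans)
qed

lemma partial_deriv_eq:
  assumes "(f has_derivative (\<lambda>w. g \<bullet> w)) (at x)"
  shows "partial_deriv i f x = g $ i"
proof -
  have "((\<lambda>s. x + s *\<^sub>R axis i 1) has_derivative (\<lambda>s. s *\<^sub>R axis i 1)) (at 0)"
    by (auto intro!: derivative_eq_intros)
  from has_derivative_compose[OF this, of f "\<lambda>w. g \<bullet> w"] assms
  have "((\<lambda>s. f (x + s *\<^sub>R axis i 1)) has_derivative (\<lambda>s. s * g $ i)) (at 0)"
    by (simp add: inner_axis)
  then have "((\<lambda>s. f (x + s *\<^sub>R axis i 1)) has_real_derivative g $ i) (at 0)"
    by (simp add: has_field_derivative_def mult_commute_abs)
  then show ?thesis unfolding partial_deriv_def by (rule DERIV_imp_deriv)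
qed

text \<open>All the estimates reduce to two: \<open>small\<close>, with coefficient 1 at the
  logarithm, for |x - y| <= 1, and \<open>large\<close>, valid for every pair.\<close>

theorem proposition2p2:
  fixes M :: "'w measure" and Z :: "'w \<Rightarrow> real ^ 'n"
    and h :: "real ^ 'n \<Rightarrow> real" and \<alpha> :: real
  assumes "std_gaussian_vector M Z"
    and "0 < \<alpha>" and "\<alpha> \<le> 1"
    and "holder_seminorm \<alpha> h < \<infinity>"
  defines "f \<equiv> stein_solution M Z h"
    and "C \<equiv> C1 \<alpha> CARD('n)"
    and "L \<equiv> enn2real (holder_seminorm \<alpha> h)"
  shows "twice_differentiable f \<and>
    (\<forall>x. laplacian f x - x \<bullet> gradient f x = h x - (LINT \<omega>|M. h (Z \<omega>))) \<and>
    (\<forall>x y. x \<noteq> y \<longrightarrow> norm (x - y) \<le> 1 \<longrightarrow>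
      op_norm (hessian f x - hessian f y)
        \<le> L * norm (x - y) powr \<alpha> * (C - 2 * ln (norm (x - y)))) \<and>
    (\<forall>x y. norm (x - y) > 1 \<longrightarrow>
      op_norm (hessian f x - hessian f y) \<le> C * L) \<and>
    (\<forall>\<beta>. 0 < \<beta> \<and> \<beta> < \<alpha> \<longrightarrow>
      (\<forall>i j. holder_seminorm \<beta> (\<lambda>x. hessian f x $ i $ j) < \<infinity>) \<and>
      (\<forall>x y. x \<noteq> y \<longrightarrow>
        op_norm (hessian f x - hessian f y)
          \<le> (C + 2 / (\<alpha> - \<beta>)) * norm (x - y) powr \<beta> * L)) \<and>
    (\<forall>x y. x \<noteq> y \<longrightarrow>
      op_norm (hessian f x - hessian f y)
        \<le> norm (x - y) powr \<alpha> * (C + \<bar>ln (norm (x - y))\<bar>) * L)"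
proof -
  note Z = std_gaussian_vector_distr[OF assms(1)]
  note [measurable] = Z(2)
  have L0: "L \<ge> 0" by (simp add: L_def)
  interpret holder_function h \<alpha> L
    using assms(2,3) holder_seminorm_bound[OF assms(4)] L0 by unfold_locales (auto simp: L_def)
  have C0: "C \<ge> 0" using C_nonneg by (simp add: C_def)
  have law: "(LINT \<omega>|M. g (Z \<omega>)) = (\<integral>z. g z \<partial>gauss)" if "g \<in> borel_measurable borel" for g :: "real ^ 'n \<Rightarrow> real"
    using integral_distr[OF Z(2) that] by (simp add: Z(1))
  have f: "f = sol"
  proof
    fix x :: "real ^ 'n"
    have inner: "(LINT \<omega>|M. h (sqrt t *\<^sub>R x + sqrt (1 - t) *\<^sub>R Z \<omega>) - h (Z \<omega>)) = interp t x - (\<integral>z. h z \<partial>gauss)" for t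
      by (subst law) (auto simp: interp_def poly_growth_integrable)
    have "(LINT t:{0..1}|lborel. 1 / (2 * t) * (interp t x - (\<integral>z. h z \<partial>gauss)))
        = (LINT t:{0<..<1}|lborel. (interp t x - (\<integral>z. h z \<partial>gauss)) / (2 * t))"
      unfolding set_lebesgue_integral_def
    proof (rule integral_cong_AE)
      \<comment> \<open>Closed and open unit interval differ by two points, a null set.\<close>
      have "AE t in lborel. t \<noteq> 0 \<and> t \<noteq> (1::real)"
        using AE_lborel_singleton[of "0::real"] AE_lborel_singleton[of "1::real"] by eventually_elim auto
      then show "AE t in lborel. indicator {0..1} t *\<^sub>R (1 / (2 * t) * (interp t x - (\<integral>z. h z \<partial>gauss)))
          = indicator {0<..<1} t *\<^sub>R ((interp t x - (\<integral>z. h z \<partial>gauss)) / (2 * t))"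
        by eventually_elim (auto simp: indicator_def)
    qed measurable
    then show "f x = sol x"
      by (simp add: f_def stein_solution_def inner sol_def integral_restrict_space set_lebesgue_integral_def)
  qed
  have grad: "partial_deriv j f x = sol_grad x $ j" for j x
    unfolding f by (rule partial_deriv_eq[OF sol_has_derivative])
  have gradient: "gradient f = sol_grad"
    by (auto simp: gradient_def grad vec_eq_iff fun_eq_iff)
  have comp: "((\<lambda>x. sol_grad x $ j) has_derivative (\<lambda>w. sol_hess x (axis j 1) \<bullet> w)) (at x)" for j x
    using sol_grad_has_derivative[of "axis j 1" x] by (simp add: inner_axis)
  have second: "partial_deriv i (partial_deriv j f) x = sol_hess x (axis j 1) $ i" for i j x
    unfolding grad by (rule partial_deriv_eq[OF comp])
  have hess: "hessian f x *v v = sol_hess x v" for x v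
  proof (rule vec_eq_iff[THEN iffD2], rule allI)
    fix i
    have "(hessian f x *v v) $ i = (\<Sum>j\<in>UNIV. sol_hess x (axis j 1) $ i * v $ j)"
      by (simp add: matrix_vector_mult_def hessian_def second)
    \<comment> \<open>Symmetry exchanges the two partial derivatives, which turns a row of the
      matrix into the vector \<open>sol_hess x (axis i 1)\<close>.\<close>
    also have "\<dots> = (\<Sum>j\<in>UNIV. sol_hess x (axis i 1) $ j * v $ j)"
      using sol_hess_symmetric[of x "axis _ 1" "axis i 1"] by (simp add: inner_axis)
    also have "\<dots> = sol_hess x (axis i 1) \<bullet> v" by (simp add: inner_vec_def)
    also have "\<dots> = sol_hess x v $ i"
      using sol_hess_symmetric[of x "axis i 1" v] by (simp add: inner_axis)
    finally show "(hessian f x *v v) $ i = sol_hess x v $ i" .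
  qed
  have op: "op_norm (hessian f x - hessian f y) \<le> K"
    if "\<And>u. norm u = 1 \<Longrightarrow> \<bar>(sol_hess x u - sol_hess y u) \<bullet> u\<bar> \<le> K" for x y K
    unfolding op_norm_def
  proof (rule onorm_le)
    show "norm ((hessian f x - hessian f y) *v v) \<le> K * norm v" for v
      using norm_sol_hess_diff_le[OF that] by (simp add: matrix_vector_mult_diff_rdistrib hess)
  qed
  \<comment> \<open>Lets the operator norm estimate pass to each second partial derivative, whose
    Hoelder seminorm is asserted to be finite.\<close>
  have op_entry: "\<bar>hessian f x $ i $ j - hessian f y $ i $ j\<bar> \<le> op_norm (hessian f x - hessian f y)" for x y i j
  proof -
    let ?A = "hessian f x - hessian f y"
    have "\<bar>?A $ i $ j\<bar> = \<bar>(?A *v axis j 1) $ i\<bar>" by (simp add: matrix_vector_mul_component inner_axis)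
    also have "\<dots> \<le> norm (?A *v axis j 1)" by (rule component_le_norm_cart)
    also have "\<dots> \<le> op_norm ?A * norm (axis j 1 :: real ^ 'n)"
      unfolding op_norm_def by (rule onorm[OF matrix_vector_mul_bounded_linear])
    finally show ?thesis by (simp add: norm_axis_1)
  qed
  have small: "op_norm (hessian f x - hessian f y) \<le> L * norm (x - y) powr \<alpha> * (C - ln (norm (x - y)))"
    if "x \<noteq> y" "norm (x - y) \<le> 1" for x y
    by (rule op) (use sol_hess_form_le_log[OF _ that] in \<open>simp add: C_def\<close>)
  have large: "op_norm (hessian f x - hessian f y) \<le> L * C" for x y
    by (rule op) (use sol_hess_form_le in \<open>simp add: C_def\<close>)
  have beta: "op_norm (hessian f x - hessian f y) \<le> (C + 2 / (\<alpha> - \<beta>)) * norm (x - y) powr \<beta> * L"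
    if "0 < \<beta>" "\<beta> < \<alpha>" "x \<noteq> y" for x y \<beta>
  proof (cases "norm (x - y) \<le> 1")
    case True
    define r where "r = norm (x - y)"
    have r: "0 < r" "r \<le> 1" using that True by (auto simp: r_def)
    have "r powr (\<alpha> - \<beta>) * C \<le> 1 * C"
      using r that C0 by (intro mult_right_mono powr_le1) auto
    moreover have "- ln r * r powr (\<alpha> - \<beta>) \<le> 1 / (\<alpha> - \<beta>)"
      using r that by (intro log_le_powr) auto
    moreover have "1 / (\<alpha> - \<beta>) \<le> 2 / (\<alpha> - \<beta>)" using that by (intro divide_right_mono) auto
    ultimately have le: "r powr (\<alpha> - \<beta>) * (C - ln r) \<le> C + 2 / (\<alpha> - \<beta>)"
      by (simp add: algebra_simps)
    have "op_norm (hessian f x - hessian f y) \<le> L * r powr \<alpha> * (C - ln r)"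
      unfolding r_def by (rule small[OF that(3) True])
    \<comment> \<open>Only r^\<beta> is kept; the surplus r^(\<alpha> - \<beta>) pays for the
      logarithm and is at most 1 in front of \<open>C\<close>.\<close>
    also have "r powr \<alpha> = r powr \<beta> * r powr (\<alpha> - \<beta>)" by (simp flip: powr_add)
    also have "L * (r powr \<beta> * r powr (\<alpha> - \<beta>)) * (C - ln r) = (L * r powr \<beta>) * (r powr (\<alpha> - \<beta>) * (C - ln r))"
      by (simp only: mult.assoc)
    also have "\<dots> \<le> (L * r powr \<beta>) * (C + 2 / (\<alpha> - \<beta>))"
      using L0 le by (intro mult_left_mono) auto
    finally show ?thesis by (simp only: r_def mult_ac)
  next
    case False
    have "L * C \<le> L * ((C + 2 / (\<alpha> - \<beta>)) * norm (x - y) powr \<beta>)"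
    proof (rule mult_left_mono[OF _ L0])
      have "C * 1 \<le> (C + 2 / (\<alpha> - \<beta>)) * norm (x - y) powr \<beta>"
        using False that C0 ge_one_powr_ge_zero[of "norm (x - y)" \<beta>] by (intro mult_mono) auto
      then show "C \<le> (C + 2 / (\<alpha> - \<beta>)) * norm (x - y) powr \<beta>" by simp
    qed
    with large[of x y] show ?thesis by (simp only: mult_ac)
  qed
  have "op_norm (hessian f x - hessian f y) \<le> L * norm (x - y) powr \<alpha> * (C - 2 * ln (norm (x - y)))"
    if "x \<noteq> y" "norm (x - y) \<le> 1" for x y
  proof -
    have "L * norm (x - y) powr \<alpha> * (C - ln (norm (x - y))) \<le> L * norm (x - y) powr \<alpha> * (C - 2 * ln (norm (x - y)))"
      using that L0 by (intro mult_left_mono) auto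
    with small[OF that] show ?thesis by linarith
  qed
  moreover have "op_norm (hessian f x - hessian f y) \<le> norm (x - y) powr \<alpha> * (C + \<bar>ln (norm (x - y))\<bar>) * L"
    if "x \<noteq> y" for x y
  proof (cases "norm (x - y) \<le> 1")
    case True
    with small[OF that True] that show ?thesis by (simp add: mult_ac)
  next
    case False
    have "L * C \<le> L * (norm (x - y) powr \<alpha> * (C + \<bar>ln (norm (x - y))\<bar>))"
    proof (rule mult_left_mono[OF _ L0])
      \<comment> \<open>For |x - y| > 1 the bound without decay suffices, since the power is at
        least 1 and the logarithmic term is nonnegative.\<close>
      have "1 * C \<le> norm (x - y) powr \<alpha> * (C + \<bar>ln (norm (x - y))\<bar>)"
        using False alpha C0 ge_one_powr_ge_zero[of "norm (x - y)" \<alpha>] by (intro mult_mono) auto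
      then show "C \<le> norm (x - y) powr \<alpha> * (C + \<bar>ln (norm (x - y))\<bar>)" by simp
    qed
    with large[of x y] show ?thesis by (simp only: mult_ac)
  qed
  moreover have "holder_seminorm \<beta> (\<lambda>x. hessian f x $ i $ j) < \<infinity>" if "0 < \<beta>" "\<beta> < \<alpha>" for \<beta> i j
  proof (rule holder_seminorm_finiteI)
    fix x y :: "real ^ 'n" assume "x \<noteq> y"
    from order_trans[OF op_entry beta[OF that this]]
    show "\<bar>hessian f x $ i $ j - hessian f y $ i $ j\<bar> \<le> ((C + 2 / (\<alpha> - \<beta>)) * L) * norm (x - y) powr \<beta>"
      by (simp add: mult_ac)
  qed
  moreover have "twice_differentiable f"
  proof -
    show ?thesis
      using sol_has_derivative sol_grad_has_derivative_vector
      unfolding twice_differentiable_def gradient unfolding f differentiable_def by blast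
  qed
  moreover have "laplacian f x - x \<bullet> gradient f x = h x - (LINT \<omega>|M. h (Z \<omega>))" for x
  proof -
    have "laplacian f x = (\<Sum>b\<in>Basis. sol_hess x b \<bullet> b)"
      unfolding Basis_vec_real by (simp add: laplacian_def second sum.reindex inj_axis_1 inner_axis)
    then show ?thesis
      using stein_equation[of x] by (simp add: gradient law inner_commute)
  qed
  ultimately show ?thesis
    using beta large by (auto simp: mult.commute[of C L])
qed

end
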